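(* Let $\Psi\mathrel{t}\Phi$ be a well-formed sequent in the language of fD.LG whose standard sequent $\lfloor\!\lfloor\Psi\rfloor\!\rfloor\mathrel{t}\lceil\!\lceil\Phi\rceil\!\rceil$ is defined. If the interpretation $(\Psi\mathrel{t}\Phi)^{\mathbb A}$ is valid in every fully polarized LG-algebra $\mathbb A$ (under every interpretation of the atoms), then the standard sequent $\lfloor\!\lfloor\Psi\rfloor\!\rfloor\mathrel{t}\lceil\!\lceil\Phi\rceil\!\rceil$ is derivable in fD.LG.
   Context: **Fully polarized LG-algebras.** A weakening relation between posets $\mathcal A,\mathcal B$ is $R\subseteq\mathcal A\times\mathcal B$ such that $a'\le a$, $a\,R\,b$, $b\le b'$ imply $a'\,R\,b'$. A fully polarized LG-algebra consists of four posets $\mathbb P,\dot{\mathbb P},\mathbb N,\dot{\mathbb N}$ with: (1) adjunctions $\uparrow\dashv\Downarrow$ ($\uparrow:\mathbb P\to\dot{\mathbb N}$, $\Downarrow:\dot{\mathbb N}\to\mathbb P$) and $\Uparrow\dashv\downarrow$ ($\Uparrow:\dot{\mathbb P}\to\mathbb N$, $\downarrow:\mathbb N\to\dot{\mathbb P}$); let $\preceq_1\subseteq\mathbb P\times\dot{\mathbb N}$ be given by $a\preceq_1 b$ iff $\uparrow a\le b$ (iff $a\le\Downarrow b$) and $\preceq_2\subseteq\dot{\mathbb P}\times\mathbb N$ by $a\preceq_2b$ iff $\Uparrow a\le b$ (iff $a\le\downarrow b$); (2) weakening relations $\preceq_+\subseteq\mathbb P\times\dot{\mathbb P}$, $\preceq\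 \subseteq\mathbb P\times\mathbb N$, $\preceq_-\subseteq\dot{\mathbb N}\times\mathbb N$ such that for $a\in\mathbb P,b\in\mathbb N$: $\uparrow a\preceq_-b$ iff $a\preceq b$ iff $a\preceq_+\downarrow b$. Put $\mathring{\mathbb P}=\mathbb P\sqcup\dot{\mathbb P}$ with order $\le_+\,=\,\le_{\mathbb P}\sqcup\preceq_+\sqcup\le_{\dot{\mathbb P}}$, $\mathring{\mathbb N}=\mathbb N\sqcup\dot{\mathbb N}$ with order $\le_-\,=\,\le_{\mathbb N}\sqcup\preceq_-\sqcup\le_{\dot{\mathbb N}}$, and $\preceq_0\,=\,\preceq_1\sqcup\preceq\sqcup\preceq_2\ \subseteq\mathring{\mathbb P}\times\mathring{\mathbb N}$; (3) operations ($\partial$ = order dual) $\otimes:\mathring{\mathbb P}\times\mathring{\mathbb P}\to\mathbb P$, $\oslash:\mathring{\mathbb P}\times\mathring{\mathbb N}^\partial\to\mathbb P$, $\ominus:\mathring{\mathbb N}^\partial\times\mathring{\mathbb P}\to\mathbb P$, $\oplus:\mathring{\mathbb N}\times\mathring{\mathbb N}\to\mathbb N$, $\backslash:\mathring{\mathbb P}^\partial\times\mathring{\mathbb N}\to\mathbb N$, $/:\mathring{\mathbb N}\times\mathring{\mathbb P}^\partial\to\mathbb N$ with (for $P,Q,R\in\mathring{\mathbb P}$, $L,M,N\in\mathring{\mathbb N}$) $Q\preceq_0P\backslash N$ iff $P\otimes Q\preceq_0N$ iff $P\preceq_0N/Q$; and $P\oslash N\preceq_0M$ iff $P\preceq_0M\oplus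 N$ iff $M\ominus P\preceq_0N$; (4) operations $\otimes_\ell:\mathring{\mathbb N}\times\mathring{\mathbb P}\to\dot{\mathbb N}$, $\oslash_\ell:\mathring{\mathbb N}\times\mathring{\mathbb N}^\partial\to\dot{\mathbb N}$, $\ominus_\ell:\mathring{\mathbb P}^\partial\times\mathring{\mathbb P}\to\dot{\mathbb N}$, $\oplus_\ell:\mathring{\mathbb P}\times\mathring{\mathbb N}\to\dot{\mathbb P}$, $\backslash_\ell:\mathring{\mathbb N}^\partial\times\mathring{\mathbb N}\to\dot{\mathbb P}$, $/_\ell:\mathring{\mathbb P}\times\mathring{\mathbb P}^\partial\to\dot{\mathbb P}$, $\otimes_r:\mathring{\mathbb P}\times\mathring{\mathbb N}\to\dot{\mathbb N}$, $\oslash_r:\mathring{\mathbb P}\times\mathring{\mathbb P}^\partial\to\dot{\mathbb N}$, $\ominus_r:\mathring{\mathbb N}^\partial\times\mathring{\mathbb N}\to\dot{\mathbb N}$, $\oplus_r:\mathring{\mathbb N}\times\mathring{\mathbb P}\to\dot{\mathbb P}$, $\backslash_r:\mathring{\mathbb P}^\partial\times\mathring{\mathbb P}\to\dot{\mathbb P}$, $/_r:\mathring{\mathbb N}\times\mathring{\mathbb N}^\partial\to\dot{\mathbb P}$ with: $Q\le_+P\backslash_rR$ iff $P\otimes Q\le_+R$ iff $P\le_+R/_\ell Q$; $L\oslash_\ell N\le_-M$ iff $L\le_-M\oplus N$ iff $M\ominus_rL\le_-N$; $Q\le_+L\backslash_\ell N$ iff $L\otimes_\ell Q\le_-N$ iff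 $L\le_-N/Q$; $P\oslash_rR\le_-M$ iff $P\le_+M\oplus_rR$ iff $M\ominus P\le_+R$; $L\le_-P\backslash N$ iff $P\otimes_rL\le_-N$ iff $P\le_+N/_rL$; $P\oslash N\le_+R$ iff $P\le_+R\oplus_\ell N$ iff $R\ominus_\ell P\le_-N$. **The calculus fD.LG.** Fix two disjoint countably infinite sets of positive atoms $p$ and negative atoms $n$. Formulas of four sorts: pure positive $P ::= p\mid \mathring P\otimes\mathring P\mid \mathring P\oslash\mathring N\mid \mathring N\ominus\mathring P$; pure negative $N ::= n\mid \mathring N\oplus\mathring N\mid \mathring P\backslash\mathring N\mid \mathring N/\mathring P$; shifted positive $\dot P ::= \,\downarrow N$; shifted negative $\dot N ::= \,\uparrow P$. A ring means "pure or shifted": $\mathring P$ (general positive) is $P$ or $\dot P$, $\mathring N$ (general negative) is $N$ or $\dot N$; same convention for structures and for $Q,M,\dots$ Structures (structural connectives carry $\hat{\ }$ or $\check{\ }$): pure positive $X ::= P\mid \check{\Downarrow}\dot\Delta\mid \mathring X\hat\otimes\mathring X\mid\mathring X\hat\oslash\mathring\Delta\mid\mathring\Delta\hat\ominus\mathring X$; pure negative $\Delta ::= N\mid\hat{\Uparrow}\dot X\mid\mathring\Delta\check\oplus\mathring\Delta\mid\mathring X\check\backslash\mathring\Delta\mid\mathring\Delta\check/\mathring X$; shifted positive $\dot X ::= \dot P\mid\check\downarrow\Delta\mid\mathring X\check\oplus_\ell\mathring\Delta\mid\mathring\Delta\check\oplus_r\mathring X\mid\mathring\Delta\check\backslash_\ell\mathring\Delta\mid\mathring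 X\check\backslash_r\mathring X\mid\mathring X\check/_\ell\mathring X\mid\mathring\Delta\check/_r\mathring\Delta$; shifted negative $\dot\Delta ::= \dot N\mid\hat\uparrow X\mid\mathring\Delta\hat\otimes_\ell\mathring X\mid\mathring X\hat\otimes_r\mathring\Delta\mid\mathring\Delta\hat\oslash_\ell\mathring\Delta\mid\mathring X\hat\oslash_r\mathring X\mid\mathring X\hat\ominus_\ell\mathring X\mid\mathring\Delta\hat\ominus_r\mathring\Delta$. The connectives with subscript $\ell$ or $r$ (variants) and $\Uparrow,\Downarrow$ exist only structurally. All other connectives have both a structural and an operational form. Sequents: positive $\mathring X\vdash_+\mathring Y$, negative $\mathring\Gamma\vdash_-\mathring\Delta$, neutral $\mathring X\vdash_0\mathring\Delta$ (the exact turnstile is determined by the sorts of both sides). Rules ($\Rightarrow$: premises to conclusion; $\Leftrightarrow$: both directions). *Axioms:* $p\vdash_+p$; $n\vdash_-n$. *Cuts:* $\mathring X\vdash_+\mathring P,\ \mathring P\vdash_+\mathring Y\Rightarrow\mathring X\vdash_+\mathring Y$; $\mathring\Gamma\vdash_-\mathring N,\ \mathring N\vdash_-\mathring\Delta\Rightarrow\mathring\Gamma\vdash_-\mathring\Delta$; $\mathring X\vdash_+\mathring P,\ \mathring P\vdash_0\mathring\Delta\Rightarrow\mathring X\vdash_0\mathring\Delta$; $\mathring X\vdash_0\mathring N,\ \mathring N\vdash_-\mathring\Delta\Rightarrow\mathring X\vdash_0\mathring\Delta$. *Translation rules:* $\mathring P\hat\otimes\mathring Q\vdash_0\mathring\Delta\Rightarrow\mathring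 P\otimes\mathring Q\vdash_0\mathring\Delta$; $\mathring P\hat\oslash\mathring N\vdash_0\mathring\Delta\Rightarrow\mathring P\oslash\mathring N\vdash_0\mathring\Delta$; $\mathring N\hat\ominus\mathring P\vdash_0\mathring\Delta\Rightarrow\mathring N\ominus\mathring P\vdash_0\mathring\Delta$; $\mathring X\vdash_0\mathring N\check\oplus\mathring M\Rightarrow\mathring X\vdash_0\mathring N\oplus\mathring M$; $\mathring X\vdash_0\mathring P\check\backslash\mathring N\Rightarrow\mathring X\vdash_0\mathring P\backslash\mathring N$; $\mathring X\vdash_0\mathring N\check/\mathring P\Rightarrow\mathring X\vdash_0\mathring N/\mathring P$; $\mathring X\vdash_+\check\downarrow N\Rightarrow\mathring X\vdash_+\downarrow N$; $\hat\uparrow P\vdash_-\mathring\Delta\Rightarrow\ \uparrow P\vdash_-\mathring\Delta$. *Tonicity rules:* $\mathring X\vdash_+\mathring P,\ \mathring Y\vdash_+\mathring Q\Rightarrow\mathring X\hat\otimes\mathring Y\vdash_+\mathring P\otimes\mathring Q$; $\mathring N\vdash_-\mathring\Gamma,\ \mathring M\vdash_-\mathring\Delta\Rightarrow\mathring N\oplus\mathring M\vdash_-\mathring\Gamma\check\oplus\mathring\Delta$; from $\mathring X\vdash_+\mathring P$ and $\mathring N\vdash_-\mathring\Delta$ infer each of $\mathring X\hat\oslash\mathring\Delta\vdash_+\mathring P\oslash\mathring N$, $\ \mathring\Delta\hat\ominus\mathring X\vdash_+\mathring N\ominus\mathring P$, $\ \mathring P\backslash\mathring N\vdash_-\mathring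 X\check\backslash\mathring\Delta$, $\ \mathring N/\mathring P\vdash_-\mathring\Delta\check/\mathring X$; $N\vdash_-\Delta\Rightarrow\ \downarrow N\vdash_+\check\downarrow\Delta$; $X\vdash_+P\Rightarrow\hat\uparrow X\vdash_-\uparrow P$. *Display postulates:* $\mathring Y\vdash_0\mathring X\check\backslash\mathring\Delta\Leftrightarrow\mathring X\hat\otimes\mathring Y\vdash_0\mathring\Delta\Leftrightarrow\mathring X\vdash_0\mathring\Delta\check/\mathring Y$; $\mathring X\hat\oslash\mathring\Delta\vdash_0\mathring\Gamma\Leftrightarrow\mathring X\vdash_0\mathring\Gamma\check\oplus\mathring\Delta\Leftrightarrow\mathring\Gamma\hat\ominus\mathring X\vdash_0\mathring\Delta$; $\mathring Y\vdash_+\mathring X\check\backslash_r\mathring Z\Leftrightarrow\mathring X\hat\otimes\mathring Y\vdash_+\mathring Z\Leftrightarrow\mathring X\vdash_+\mathring Z\check/_\ell\mathring Y$; $\mathring\Sigma\hat\oslash_\ell\mathring\Delta\vdash_-\mathring\Gamma\Leftrightarrow\mathring\Sigma\vdash_-\mathring\Gamma\check\oplus\mathring\Delta\Leftrightarrow\mathring\Gamma\hat\ominus_r\mathring\Sigma\vdash_-\mathring\Delta$; $\mathring\Gamma\hat\ominus\mathring X\vdash_+\mathring Y\Leftrightarrow\mathring X\vdash_+\mathring\Gamma\check\oplus_r\mathring Y\Leftrightarrow\mathring X\hat\oslash_r\mathring Y\vdash_-\mathring\Gamma$; $\mathring X\hat\oslash\mathring\Delta\vdash_+\mathring Y\Leftrightarrow\mathring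 X\vdash_+\mathring Y\check\oplus_\ell\mathring\Delta\Leftrightarrow\mathring Y\hat\ominus_\ell\mathring X\vdash_-\mathring\Delta$; $\mathring\Gamma\vdash_-\mathring X\check\backslash\mathring\Delta\Leftrightarrow\mathring X\hat\otimes_r\mathring\Gamma\vdash_-\mathring\Delta\Leftrightarrow\mathring X\vdash_+\mathring\Delta\check/_r\mathring\Gamma$; $\mathring Y\vdash_+\mathring\Gamma\check\backslash_\ell\mathring\Delta\Leftrightarrow\mathring\Gamma\hat\otimes_\ell\mathring Y\vdash_-\mathring\Delta\Leftrightarrow\mathring\Gamma\vdash_-\mathring\Delta\check/\mathring Y$; $\hat\uparrow X\vdash_-\dot\Delta\Leftrightarrow X\vdash_+\check\Downarrow\dot\Delta$; $\hat\uparrow X\vdash_-\Delta\Leftrightarrow X\vdash_+\check\downarrow\Delta$; $\dot X\vdash_+\check\downarrow\Delta\Leftrightarrow\hat\Uparrow\dot X\vdash_-\Delta$. *Structural rules:* $\mathring X\vdash_0\Delta\Leftrightarrow\mathring X\vdash_+\check\downarrow\Delta$; $X\vdash_0\mathring\Delta\Leftrightarrow\hat\uparrow X\vdash_-\mathring\Delta$. **Interpretation.** An interpretation in $\mathbb A$ assigns to each positive atom an element of $\mathbb P$ and to each negative atom an element of $\mathbb N$, extended homomorphically to formulas and structures (a structural connective and its operational counterpart are interpreted by the operation of the same name). The turnstiles $\vdash_+,\vdash_-,\vdash_0$ are interpreted by $\le_+,\le_-,\preceq_0$. **Standard sequents.** $\mathcal F$-connectives: $\otimes,\oslash,\ominus$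 with their variants, $\uparrow,\Uparrow$. $\mathcal G$-connectives: $\oplus,\backslash,/$ with their variants, $\downarrow,\Downarrow$. Order-types (same for variants): $\otimes,\oplus$: $(1,1)$; $\ominus,\backslash$: $(\partial,1)$; $\oslash,/$: $(1,\partial)$; shifts: $(1)$. The signed generation tree $+\Psi$ (resp. $-\Psi$) labels the root of the syntax tree with $+$ (resp. $-$) and passes the same sign to the $i$-th child if the order-type at $i$ is $1$, the opposite sign if it is $\partial$. A connective node is skeleton if labelled $+f$ with $f\in\mathcal F$ or $-g$ with $g\in\mathcal G$, and PIA otherwise. The principal subtree of a signed structure is the largest (connected) subtree containing the root which consists only of skeleton nodes or only of PIA nodes. $\lfloor\!\lfloor\Psi\rfloor\!\rfloor$ (resp. $\lceil\!\lceil\Psi\rceil\!\rceil$) is the structure of the same sort obtained, when defined, by turning every connective of the principal subtree $\Sigma$ of $+\Psi$ (resp. $-\Psi$) into its structural counterpart if $\Sigma$ is skeleton and into its operational counterpart if $\Sigma$ is PIA, and turning all other connectives into their operational counterparts; it is undefined if a required operational counterpart does not exist. The standard sequent of $\Psi\mathrel{t}\Phi$ is $\lfloor\!\lfloor\Psi\rfloor\!\rfloor\mathrel{t}\lceil\!\lceil\Phi\rceil\!\rceil$. *)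

theory Defs
  imports Main
begin

section \<open>Fully polarized LG-algebras\<close>

text \<open>
  The component posets are carrier sets inside the types \<open>'p\<close> (for P), \<open>'sp\<close> (for dotted P),
  \<open>'n\<close> (for N) and \<open>'sn\<close> (for dotted N); relations and operations are only constrained on the
  carriers.  Ringed sorts are disjoint unions, with \<open>Inl\<close> for pure and \<open>Inr\<close> for shifted elements,
  so the operations on them take arguments in \<open>'p + 'sp\<close> and \<open>'n + 'sn\<close>.
\<close>

record ('p, 'sp, 'n, 'sn) lg_structure =
  carP :: "'p set"
  carSP :: "'sp set"
  carN :: "'n set"
  carSN :: "'sn set"
  leP :: "'p \<Rightarrow> 'p \<Rightarrow> bool"
  leSP :: "'sp \<Rightarrow> 'sp \<Rightarrow> bool"
  leN :: "'n \<Rightarrow> 'n \<Rightarrow> bool"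
  leSN :: "'sn \<Rightarrow> 'sn \<Rightarrow> bool"
  up :: "'p \<Rightarrow> 'sn"          \<comment> \<open>single up arrow\<close>
  ddown :: "'sn \<Rightarrow> 'p"       \<comment> \<open>double down arrow\<close>
  uup :: "'sp \<Rightarrow> 'n"         \<comment> \<open>double up arrow\<close>
  down :: "'n \<Rightarrow> 'sp"        \<comment> \<open>single down arrow\<close>
  relPos :: "'p \<Rightarrow> 'sp \<Rightarrow> bool"
  relNeut :: "'p \<Rightarrow> 'n \<Rightarrow> bool"
  relNeg :: "'sn \<Rightarrow> 'n \<Rightarrow> bool"
  tens :: "'p + 'sp \<Rightarrow> 'p + 'sp \<Rightarrow> 'p"
  osl :: "'p + 'sp \<Rightarrow> 'n + 'sn \<Rightarrow> 'p"
  omin :: "'n + 'sn \<Rightarrow> 'p + 'sp \<Rightarrow> 'p"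
  opl :: "'n + 'sn \<Rightarrow> 'n + 'sn \<Rightarrow> 'n"
  bsl :: "'p + 'sp \<Rightarrow> 'n + 'sn \<Rightarrow> 'n"
  sla :: "'n + 'sn \<Rightarrow> 'p + 'sp \<Rightarrow> 'n"
  tensl :: "'n + 'sn \<Rightarrow> 'p + 'sp \<Rightarrow> 'sn"
  osll :: "'n + 'sn \<Rightarrow> 'n + 'sn \<Rightarrow> 'sn"
  ominl :: "'p + 'sp \<Rightarrow> 'p + 'sp \<Rightarrow> 'sn"
  opll :: "'p + 'sp \<Rightarrow> 'n + 'sn \<Rightarrow> 'sp"
  bsll :: "'n + 'sn \<Rightarrow> 'n + 'sn \<Rightarrow> 'sp"
  slal :: "'p + 'sp \<Rightarrow> 'p + 'sp \<Rightarrow> 'sp"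
  tensr :: "'p + 'sp \<Rightarrow> 'n + 'sn \<Rightarrow> 'sn"
  oslr :: "'p + 'sp \<Rightarrow> 'p + 'sp \<Rightarrow> 'sn"
  ominr :: "'n + 'sn \<Rightarrow> 'n + 'sn \<Rightarrow> 'sn"
  oplr :: "'n + 'sn \<Rightarrow> 'p + 'sp \<Rightarrow> 'sp"
  bslr :: "'p + 'sp \<Rightarrow> 'p + 'sp \<Rightarrow> 'sp"
  slar :: "'n + 'sn \<Rightarrow> 'n + 'sn \<Rightarrow> 'sp"

definition poset_on :: "'a set \<Rightarrow> ('a \<Rightarrow> 'a \<Rightarrow> bool) \<Rightarrow> bool" where
  "poset_on A le \<longleftrightarrow> reflp_on A le \<and> transp_on A le \<and> antisymp_on A le"

definition weakening_relation ::
  "'a set \<Rightarrow> ('a \<Rightarrow> 'a \<Rightarrow> bool) \<Rightarrow> 'b set \<Rightarrow> ('b \<Rightarrow> 'b \<Rightarrow> bool) \<Rightarrow> ('a \<Rightarrow> 'b \<Rightarrow> bool) \<Rightarrow> bool" where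
  "weakening_relation A leA B leB R \<longleftrightarrow>
     (\<forall>a'\<in>A. \<forall>a\<in>A. \<forall>b\<in>B. \<forall>b'\<in>B. leA a' a \<longrightarrow> R a b \<longrightarrow> leB b b' \<longrightarrow> R a' b')"

definition adjunction ::
  "'a set \<Rightarrow> ('a \<Rightarrow> 'a \<Rightarrow> bool) \<Rightarrow> 'b set \<Rightarrow> ('b \<Rightarrow> 'b \<Rightarrow> bool) \<Rightarrow> ('a \<Rightarrow> 'b) \<Rightarrow> ('b \<Rightarrow> 'a) \<Rightarrow> bool" where
  "adjunction A leA B leB f g \<longleftrightarrow>
     f ` A \<subseteq> B \<and> g ` B \<subseteq> A \<and> monotone_on A leA leB f \<and> monotone_on B leB leA g \<and>
     (\<forall>a\<in>A. \<forall>b\<in>B. leB (f a) b \<longleftrightarrow> leA a (g b))"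

text \<open>An order-preserving binary operation between posets; an order dual in the signature is
  rendered by passing the converse order.\<close>

definition operation ::
  "'a set \<Rightarrow> ('a \<Rightarrow> 'a \<Rightarrow> bool) \<Rightarrow> 'b set \<Rightarrow> ('b \<Rightarrow> 'b \<Rightarrow> bool) \<Rightarrow>
   'c set \<Rightarrow> ('c \<Rightarrow> 'c \<Rightarrow> bool) \<Rightarrow> ('a \<Rightarrow> 'b \<Rightarrow> 'c) \<Rightarrow> bool" where
  "operation A leA B leB C leC f \<longleftrightarrow>
     (\<forall>a\<in>A. \<forall>b\<in>B. f a b \<in> C) \<and>
     (\<forall>a\<in>A. \<forall>a'\<in>A. \<forall>b\<in>B. \<forall>b'\<in>B. leA a a' \<longrightarrow> leB b b' \<longrightarrow> leC (f a b) (f a' b'))"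

definition gcarP :: "('p, 'sp, 'n, 'sn) lg_structure \<Rightarrow> ('p + 'sp) set" where
  "gcarP A = carP A <+> carSP A"

definition gcarN :: "('p, 'sp, 'n, 'sn) lg_structure \<Rightarrow> ('n + 'sn) set" where
  "gcarN A = carN A <+> carSN A"

fun le_pos :: "('p, 'sp, 'n, 'sn) lg_structure \<Rightarrow> 'p + 'sp \<Rightarrow> 'p + 'sp \<Rightarrow> bool" where
  "le_pos A (Inl a) (Inl b) \<longleftrightarrow> leP A a b"
| "le_pos A (Inl a) (Inr b) \<longleftrightarrow> relPos A a b"
| "le_pos A (Inr a) (Inr b) \<longleftrightarrow> leSP A a b"
| "le_pos A (Inr a) (Inl b) \<longleftrightarrow> False"

fun le_neg :: "('p, 'sp, 'n, 'sn) lg_structure \<Rightarrow> 'n + 'sn \<Rightarrow> 'n + 'sn \<Rightarrow> bool" where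
  "le_neg A (Inl a) (Inl b) \<longleftrightarrow> leN A a b"
| "le_neg A (Inr a) (Inl b) \<longleftrightarrow> relNeg A a b"
| "le_neg A (Inr a) (Inr b) \<longleftrightarrow> leSN A a b"
| "le_neg A (Inl a) (Inr b) \<longleftrightarrow> False"

text \<open>The neutral relation is empty between shifted positive and shifted negative elements.\<close>

fun le_neut :: "('p, 'sp, 'n, 'sn) lg_structure \<Rightarrow> 'p + 'sp \<Rightarrow> 'n + 'sn \<Rightarrow> bool" where
  "le_neut A (Inl a) (Inr b) \<longleftrightarrow> leSN A (up A a) b"
| "le_neut A (Inl a) (Inl b) \<longleftrightarrow> relNeut A a b"
| "le_neut A (Inr a) (Inl b) \<longleftrightarrow> leN A (uup A a) b"
| "le_neut A (Inr a) (Inr b) \<longleftrightarrow> False"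

definition fp_lg_algebra :: "('p, 'sp, 'n, 'sn) lg_structure \<Rightarrow> bool" where
  "fp_lg_algebra A \<longleftrightarrow>
     poset_on (carP A) (leP A) \<and> poset_on (carSP A) (leSP A) \<and>
     poset_on (carN A) (leN A) \<and> poset_on (carSN A) (leSN A) \<and>
     adjunction (carP A) (leP A) (carSN A) (leSN A) (up A) (ddown A) \<and>
     adjunction (carSP A) (leSP A) (carN A) (leN A) (uup A) (down A) \<and>
     weakening_relation (carP A) (leP A) (carSP A) (leSP A) (relPos A) \<and>
     weakening_relation (carP A) (leP A) (carN A) (leN A) (relNeut A) \<and>
     weakening_relation (carSN A) (leSN A) (carN A) (leN A) (relNeg A) \<and>
     (\<forall>a\<in>carP A. \<forall>b\<in>carN A.
        (relNeg A (up A a) b \<longleftrightarrow> relNeut A a b) \<and> (relNeut A a b \<longleftrightarrow> relPos A a (down A b))) \<and>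
     (let GP = gcarP A; GN = gcarN A; leGP = le_pos A; leGN = le_neg A;
          dGP = (le_pos A)\<inverse>\<inverse>; dGN = (le_neg A)\<inverse>\<inverse> in
        operation GP leGP GP leGP (carP A) (leP A) (tens A) \<and>
        operation GP leGP GN dGN (carP A) (leP A) (osl A) \<and>
        operation GN dGN GP leGP (carP A) (leP A) (omin A) \<and>
        operation GN leGN GN leGN (carN A) (leN A) (opl A) \<and>
        operation GP dGP GN leGN (carN A) (leN A) (bsl A) \<and>
        operation GN leGN GP dGP (carN A) (leN A) (sla A) \<and>
        operation GN leGN GP leGP (carSN A) (leSN A) (tensl A) \<and>
        operation GN leGN GN dGN (carSN A) (leSN A) (osll A) \<and>
        operation GP dGP GP leGP (carSN A) (leSN A) (ominl A) \<and>
        operation GP leGP GN leGN (carSP A) (leSP A) (opll A) \<and>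
        operation GN dGN GN leGN (carSP A) (leSP A) (bsll A) \<and>
        operation GP leGP GP dGP (carSP A) (leSP A) (slal A) \<and>
        operation GP leGP GN leGN (carSN A) (leSN A) (tensr A) \<and>
        operation GP leGP GP dGP (carSN A) (leSN A) (oslr A) \<and>
        operation GN dGN GN leGN (carSN A) (leSN A) (ominr A) \<and>
        operation GN leGN GP leGP (carSP A) (leSP A) (oplr A) \<and>
        operation GP dGP GP leGP (carSP A) (leSP A) (bslr A) \<and>
        operation GN leGN GN dGN (carSP A) (leSP A) (slar A) \<and>
        (\<forall>P\<in>GP. \<forall>Q\<in>GP. \<forall>N\<in>GN.
           (le_neut A Q (Inl (bsl A P N)) \<longleftrightarrow> le_neut A (Inl (tens A P Q)) N) \<and>
           (le_neut A (Inl (tens A P Q)) N \<longleftrightarrow> le_neut A P (Inl (sla A N Q)))) \<and>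
        (\<forall>P\<in>GP. \<forall>M\<in>GN. \<forall>N\<in>GN.
           (le_neut A (Inl (osl A P N)) M \<longleftrightarrow> le_neut A P (Inl (opl A M N))) \<and>
           (le_neut A P (Inl (opl A M N)) \<longleftrightarrow> le_neut A (Inl (omin A M P)) N)) \<and>
        (\<forall>P\<in>GP. \<forall>Q\<in>GP. \<forall>R\<in>GP.
           (le_pos A Q (Inr (bslr A P R)) \<longleftrightarrow> le_pos A (Inl (tens A P Q)) R) \<and>
           (le_pos A (Inl (tens A P Q)) R \<longleftrightarrow> le_pos A P (Inr (slal A R Q)))) \<and>
        (\<forall>L\<in>GN. \<forall>M\<in>GN. \<forall>N\<in>GN.
           (le_neg A (Inr (osll A L N)) M \<longleftrightarrow> le_neg A L (Inl (opl A M N))) \<and>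
           (le_neg A L (Inl (opl A M N)) \<longleftrightarrow> le_neg A (Inr (ominr A M L)) N)) \<and>
        (\<forall>Q\<in>GP. \<forall>L\<in>GN. \<forall>N\<in>GN.
           (le_pos A Q (Inr (bsll A L N)) \<longleftrightarrow> le_neg A (Inr (tensl A L Q)) N) \<and>
           (le_neg A (Inr (tensl A L Q)) N \<longleftrightarrow> le_neg A L (Inl (sla A N Q)))) \<and>
        (\<forall>P\<in>GP. \<forall>R\<in>GP. \<forall>M\<in>GN.
           (le_neg A (Inr (oslr A P R)) M \<longleftrightarrow> le_pos A P (Inr (oplr A M R))) \<and>
           (le_pos A P (Inr (oplr A M R)) \<longleftrightarrow> le_pos A (Inl (omin A M P)) R)) \<and>
        (\<forall>P\<in>GP. \<forall>L\<in>GN. \<forall>N\<in>GN.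
           (le_neg A L (Inl (bsl A P N)) \<longleftrightarrow> le_neg A (Inr (tensr A P L)) N) \<and>
           (le_neg A (Inr (tensr A P L)) N \<longleftrightarrow> le_pos A P (Inr (slar A N L)))) \<and>
        (\<forall>P\<in>GP. \<forall>R\<in>GP. \<forall>N\<in>GN.
           (le_pos A (Inl (osl A P N)) R \<longleftrightarrow> le_pos A P (Inr (opll A R N))) \<and>
           (le_pos A P (Inr (opll A R N)) \<longleftrightarrow> le_neg A (Inr (ominl A R P)) N)))"


section \<open>Formulas, structures and sequents\<close>

text \<open>
  One type per sort, so that every term is well-sorted: \<open>pos\<close>/\<open>neg\<close> are the pure sorts,
  \<open>spos\<close>/\<open>sneg\<close> the shifted ones, \<open>gpos\<close>/\<open>gneg\<close> the general (ringed) ones.  The subscript \<open>o\<close>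
  marks operational connectives, \<open>s\<close> structural ones; connectives with subscript \<open>l\<close> or \<open>r\<close> and
  the double arrows exist only as structural connectives.  \<open>\<setminus>\<close> is the left residual.
\<close>

datatype
  pos_fm = PAtom nat
    | TensF gpos_fm gpos_fm (infix \<open>\<otimes>\<^sub>o\<close> 70)
    | OslF gpos_fm gneg_fm (infix \<open>\<oslash>\<^sub>o\<close> 70)
    | OminF gneg_fm gpos_fm (infix \<open>\<ominus>\<^sub>o\<close> 70)
and neg_fm = NAtom nat
    | OplF gneg_fm gneg_fm (infix \<open>\<oplus>\<^sub>o\<close> 70)
    | BslF gpos_fm gneg_fm (infix \<open>\<setminus>\<^sub>o\<close> 70)
    | SlaF gneg_fm gpos_fm (infix \<open>'/\<^sub>o\<close> 70)
and spos_fm = DownF neg_fm (\<open>\<down>\<^sub>o _\<close> [80] 80)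
and sneg_fm = UpF pos_fm (\<open>\<up>\<^sub>o _\<close> [80] 80)
and gpos_fm = PureP pos_fm | ShiftP spos_fm
and gneg_fm = PureN neg_fm | ShiftN sneg_fm

datatype
  pos_st = FmP pos_fm
    | DDown sneg_st (\<open>\<Down>\<^sub>s _\<close> [80] 80)
    | Tens gpos_st gpos_st (infix \<open>\<otimes>\<^sub>s\<close> 70)
    | Osl gpos_st gneg_st (infix \<open>\<oslash>\<^sub>s\<close> 70)
    | Omin gneg_st gpos_st (infix \<open>\<ominus>\<^sub>s\<close> 70)
and neg_st = FmN neg_fm
    | UUp spos_st (\<open>\<Up>\<^sub>s _\<close> [80] 80)
    | Opl gneg_st gneg_st (infix \<open>\<oplus>\<^sub>s\<close> 70)
    | Bsl gpos_st gneg_st (infix \<open>\<setminus>\<^sub>s\<close> 70)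
    | Sla gneg_st gpos_st (infix \<open>'/\<^sub>s\<close> 70)
and spos_st = FmSP spos_fm
    | Down neg_st (\<open>\<down>\<^sub>s _\<close> [80] 80)
    | OplL gpos_st gneg_st (infix \<open>\<oplus>\<^sub>l\<close> 70)
    | OplR gneg_st gpos_st (infix \<open>\<oplus>\<^sub>r\<close> 70)
    | BslL gneg_st gneg_st (infix \<open>\<setminus>\<^sub>l\<close> 70)
    | BslR gpos_st gpos_st (infix \<open>\<setminus>\<^sub>r\<close> 70)
    | SlaL gpos_st gpos_st (infix \<open>'/\<^sub>l\<close> 70)
    | SlaR gneg_st gneg_st (infix \<open>'/\<^sub>r\<close> 70)
and sneg_st = FmSN sneg_fm
    | Up pos_st (\<open>\<up>\<^sub>s _\<close> [80] 80)
    | TensL gneg_st gpos_st (infix \<open>\<otimes>\<^sub>l\<close> 70)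
    | TensR gpos_st gneg_st (infix \<open>\<otimes>\<^sub>r\<close> 70)
    | OslL gneg_st gneg_st (infix \<open>\<oslash>\<^sub>l\<close> 70)
    | OslR gpos_st gpos_st (infix \<open>\<oslash>\<^sub>r\<close> 70)
    | OminL gpos_st gpos_st (infix \<open>\<ominus>\<^sub>l\<close> 70)
    | OminR gneg_st gneg_st (infix \<open>\<ominus>\<^sub>r\<close> 70)
and gpos_st = PuP pos_st | ShP spos_st
and gneg_st = PuN neg_st | ShN sneg_st

datatype sequent =
    PosSeq gpos_st gpos_st (infix \<open>\<turnstile>\<^sub>+\<close> 50)
  | NegSeq gneg_st gneg_st (infix \<open>\<turnstile>\<^sub>-\<close> 50)
  | NeutSeq gpos_st gneg_st (infix \<open>\<turnstile>\<^sub>0\<close> 50)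

fun fmP :: "gpos_fm \<Rightarrow> gpos_st" (\<open>\<langle>_\<rangle>\<^sub>+\<close>) where
  "\<langle>PureP A\<rangle>\<^sub>+ = PuP (FmP A)"
| "\<langle>ShiftP A\<rangle>\<^sub>+ = ShP (FmSP A)"

fun fmN :: "gneg_fm \<Rightarrow> gneg_st" (\<open>\<langle>_\<rangle>\<^sub>-\<close>) where
  "\<langle>PureN A\<rangle>\<^sub>- = PuN (FmN A)"
| "\<langle>ShiftN A\<rangle>\<^sub>- = ShN (FmSN A)"


section \<open>The calculus\<close>

text \<open>The invertible rules (display postulates and structural rules), each listed once; a double
  equivalence is given by two clauses sharing the middle sequent.\<close>

inductive invertible_rule :: "sequent \<Rightarrow> sequent \<Rightarrow> bool" (infix \<open>\<rightleftharpoons>\<close> 40) where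
  "Y \<turnstile>\<^sub>0 PuN (X \<setminus>\<^sub>s D) \<rightleftharpoons> PuP (X \<otimes>\<^sub>s Y) \<turnstile>\<^sub>0 D"
| "PuP (X \<otimes>\<^sub>s Y) \<turnstile>\<^sub>0 D \<rightleftharpoons> X \<turnstile>\<^sub>0 PuN (D /\<^sub>s Y)"
| "PuP (X \<oslash>\<^sub>s D) \<turnstile>\<^sub>0 G \<rightleftharpoons> X \<turnstile>\<^sub>0 PuN (G \<oplus>\<^sub>s D)"
| "X \<turnstile>\<^sub>0 PuN (G \<oplus>\<^sub>s D) \<rightleftharpoons> PuP (G \<ominus>\<^sub>s X) \<turnstile>\<^sub>0 D"
| "Y \<turnstile>\<^sub>+ ShP (X \<setminus>\<^sub>r Z) \<rightleftharpoons> PuP (X \<otimes>\<^sub>s Y) \<turnstile>\<^sub>+ Z"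
| "PuP (X \<otimes>\<^sub>s Y) \<turnstile>\<^sub>+ Z \<rightleftharpoons> X \<turnstile>\<^sub>+ ShP (Z /\<^sub>l Y)"
| "ShN (S \<oslash>\<^sub>l D) \<turnstile>\<^sub>- G \<rightleftharpoons> S \<turnstile>\<^sub>- PuN (G \<oplus>\<^sub>s D)"
| "S \<turnstile>\<^sub>- PuN (G \<oplus>\<^sub>s D) \<rightleftharpoons> ShN (G \<ominus>\<^sub>r S) \<turnstile>\<^sub>- D"
| "PuP (G \<ominus>\<^sub>s X) \<turnstile>\<^sub>+ Y \<rightleftharpoons> X \<turnstile>\<^sub>+ ShP (G \<oplus>\<^sub>r Y)"
| "X \<turnstile>\<^sub>+ ShP (G \<oplus>\<^sub>r Y) \<rightleftharpoons> ShN (X \<oslash>\<^sub>r Y) \<turnstile>\<^sub>- G"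
| "PuP (X \<oslash>\<^sub>s D) \<turnstile>\<^sub>+ Y \<rightleftharpoons> X \<turnstile>\<^sub>+ ShP (Y \<oplus>\<^sub>l D)"
| "X \<turnstile>\<^sub>+ ShP (Y \<oplus>\<^sub>l D) \<rightleftharpoons> ShN (Y \<ominus>\<^sub>l X) \<turnstile>\<^sub>- D"
| "G \<turnstile>\<^sub>- PuN (X \<setminus>\<^sub>s D) \<rightleftharpoons> ShN (X \<otimes>\<^sub>r G) \<turnstile>\<^sub>- D"
| "ShN (X \<otimes>\<^sub>r G) \<turnstile>\<^sub>- D \<rightleftharpoons> X \<turnstile>\<^sub>+ ShP (D /\<^sub>r G)"
| "Y \<turnstile>\<^sub>+ ShP (G \<setminus>\<^sub>l D) \<rightleftharpoons> ShN (G \<otimes>\<^sub>l Y) \<turnstile>\<^sub>- D"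
| "ShN (G \<otimes>\<^sub>l Y) \<turnstile>\<^sub>- D \<rightleftharpoons> G \<turnstile>\<^sub>- PuN (D /\<^sub>s Y)"
| "ShN (\<up>\<^sub>s X) \<turnstile>\<^sub>- ShN D \<rightleftharpoons> PuP X \<turnstile>\<^sub>+ PuP (\<Down>\<^sub>s D)"
| "ShN (\<up>\<^sub>s X) \<turnstile>\<^sub>- PuN D \<rightleftharpoons> PuP X \<turnstile>\<^sub>+ ShP (\<down>\<^sub>s D)"
| "ShP X \<turnstile>\<^sub>+ ShP (\<down>\<^sub>s D) \<rightleftharpoons> PuN (\<Up>\<^sub>s X) \<turnstile>\<^sub>- PuN D"
| "X \<turnstile>\<^sub>0 PuN D \<rightleftharpoons> X \<turnstile>\<^sub>+ ShP (\<down>\<^sub>s D)"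
| "PuP X \<turnstile>\<^sub>0 D \<rightleftharpoons> ShN (\<up>\<^sub>s X) \<turnstile>\<^sub>- D"

inductive derivable :: "sequent \<Rightarrow> bool" where
  ax_pos: "derivable (\<langle>PureP (PAtom i)\<rangle>\<^sub>+ \<turnstile>\<^sub>+ \<langle>PureP (PAtom i)\<rangle>\<^sub>+)"
| ax_neg: "derivable (\<langle>PureN (NAtom i)\<rangle>\<^sub>- \<turnstile>\<^sub>- \<langle>PureN (NAtom i)\<rangle>\<^sub>-)"
| cut_pos: "derivable (X \<turnstile>\<^sub>+ \<langle>A\<rangle>\<^sub>+) \<Longrightarrow> derivable (\<langle>A\<rangle>\<^sub>+ \<turnstile>\<^sub>+ Y) \<Longrightarrow> derivable (X \<turnstile>\<^sub>+ Y)"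
| cut_neg: "derivable (G \<turnstile>\<^sub>- \<langle>B\<rangle>\<^sub>-) \<Longrightarrow> derivable (\<langle>B\<rangle>\<^sub>- \<turnstile>\<^sub>- D) \<Longrightarrow> derivable (G \<turnstile>\<^sub>- D)"
| cut_neut_pos: "derivable (X \<turnstile>\<^sub>+ \<langle>A\<rangle>\<^sub>+) \<Longrightarrow> derivable (\<langle>A\<rangle>\<^sub>+ \<turnstile>\<^sub>0 D) \<Longrightarrow> derivable (X \<turnstile>\<^sub>0 D)"
| cut_neut_neg: "derivable (X \<turnstile>\<^sub>0 \<langle>B\<rangle>\<^sub>-) \<Longrightarrow> derivable (\<langle>B\<rangle>\<^sub>- \<turnstile>\<^sub>- D) \<Longrightarrow> derivable (X \<turnstile>\<^sub>0 D)"
| inv_fwd: "S \<rightleftharpoons> T \<Longrightarrow> derivable S \<Longrightarrow> derivable T"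
| inv_bwd: "S \<rightleftharpoons> T \<Longrightarrow> derivable T \<Longrightarrow> derivable S"
| tr_tens: "derivable (PuP (\<langle>A\<rangle>\<^sub>+ \<otimes>\<^sub>s \<langle>B\<rangle>\<^sub>+) \<turnstile>\<^sub>0 D) \<Longrightarrow> derivable (\<langle>PureP (A \<otimes>\<^sub>o B)\<rangle>\<^sub>+ \<turnstile>\<^sub>0 D)"
| tr_osl: "derivable (PuP (\<langle>A\<rangle>\<^sub>+ \<oslash>\<^sub>s \<langle>B\<rangle>\<^sub>-) \<turnstile>\<^sub>0 D) \<Longrightarrow> derivable (\<langle>PureP (A \<oslash>\<^sub>o B)\<rangle>\<^sub>+ \<turnstile>\<^sub>0 D)"
| tr_omin: "derivable (PuP (\<langle>B\<rangle>\<^sub>- \<ominus>\<^sub>s \<langle>A\<rangle>\<^sub>+) \<turnstile>\<^sub>0 D) \<Longrightarrow> derivable (\<langle>PureP (B \<ominus>\<^sub>o A)\<rangle>\<^sub>+ \<turnstile>\<^sub>0 D)"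
| tr_opl: "derivable (X \<turnstile>\<^sub>0 PuN (\<langle>A\<rangle>\<^sub>- \<oplus>\<^sub>s \<langle>B\<rangle>\<^sub>-)) \<Longrightarrow> derivable (X \<turnstile>\<^sub>0 \<langle>PureN (A \<oplus>\<^sub>o B)\<rangle>\<^sub>-)"
| tr_bsl: "derivable (X \<turnstile>\<^sub>0 PuN (\<langle>A\<rangle>\<^sub>+ \<setminus>\<^sub>s \<langle>B\<rangle>\<^sub>-)) \<Longrightarrow> derivable (X \<turnstile>\<^sub>0 \<langle>PureN (A \<setminus>\<^sub>o B)\<rangle>\<^sub>-)"
| tr_sla: "derivable (X \<turnstile>\<^sub>0 PuN (\<langle>B\<rangle>\<^sub>- /\<^sub>s \<langle>A\<rangle>\<^sub>+)) \<Longrightarrow> derivable (X \<turnstile>\<^sub>0 \<langle>PureN (B /\<^sub>o A)\<rangle>\<^sub>-)"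
| tr_down: "derivable (X \<turnstile>\<^sub>+ ShP (\<down>\<^sub>s (FmN B))) \<Longrightarrow> derivable (X \<turnstile>\<^sub>+ \<langle>ShiftP (\<down>\<^sub>o B)\<rangle>\<^sub>+)"
| tr_up: "derivable (ShN (\<up>\<^sub>s (FmP A)) \<turnstile>\<^sub>- D) \<Longrightarrow> derivable (\<langle>ShiftN (\<up>\<^sub>o A)\<rangle>\<^sub>- \<turnstile>\<^sub>- D)"
| ton_tens: "derivable (X \<turnstile>\<^sub>+ \<langle>A\<rangle>\<^sub>+) \<Longrightarrow> derivable (Y \<turnstile>\<^sub>+ \<langle>B\<rangle>\<^sub>+) \<Longrightarrow>
    derivable (PuP (X \<otimes>\<^sub>s Y) \<turnstile>\<^sub>+ \<langle>PureP (A \<otimes>\<^sub>o B)\<rangle>\<^sub>+)"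
| ton_opl: "derivable (\<langle>A\<rangle>\<^sub>- \<turnstile>\<^sub>- G) \<Longrightarrow> derivable (\<langle>B\<rangle>\<^sub>- \<turnstile>\<^sub>- D) \<Longrightarrow>
    derivable (\<langle>PureN (A \<oplus>\<^sub>o B)\<rangle>\<^sub>- \<turnstile>\<^sub>- PuN (G \<oplus>\<^sub>s D))"
| ton_osl: "derivable (X \<turnstile>\<^sub>+ \<langle>A\<rangle>\<^sub>+) \<Longrightarrow> derivable (\<langle>B\<rangle>\<^sub>- \<turnstile>\<^sub>- D) \<Longrightarrow>
    derivable (PuP (X \<oslash>\<^sub>s D) \<turnstile>\<^sub>+ \<langle>PureP (A \<oslash>\<^sub>o B)\<rangle>\<^sub>+)"
| ton_omin: "derivable (X \<turnstile>\<^sub>+ \<langle>A\<rangle>\<^sub>+) \<Longrightarrow> derivable (\<langle>B\<rangle>\<^sub>- \<turnstile>\<^sub>- D) \<Longrightarrow>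
    derivable (PuP (D \<ominus>\<^sub>s X) \<turnstile>\<^sub>+ \<langle>PureP (B \<ominus>\<^sub>o A)\<rangle>\<^sub>+)"
| ton_bsl: "derivable (X \<turnstile>\<^sub>+ \<langle>A\<rangle>\<^sub>+) \<Longrightarrow> derivable (\<langle>B\<rangle>\<^sub>- \<turnstile>\<^sub>- D) \<Longrightarrow>
    derivable (\<langle>PureN (A \<setminus>\<^sub>o B)\<rangle>\<^sub>- \<turnstile>\<^sub>- PuN (X \<setminus>\<^sub>s D))"
| ton_sla: "derivable (X \<turnstile>\<^sub>+ \<langle>A\<rangle>\<^sub>+) \<Longrightarrow> derivable (\<langle>B\<rangle>\<^sub>- \<turnstile>\<^sub>- D) \<Longrightarrow>
    derivable (\<langle>PureN (B /\<^sub>o A)\<rangle>\<^sub>- \<turnstile>\<^sub>- PuN (D /\<^sub>s X))"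
| ton_down: "derivable (PuN (FmN B) \<turnstile>\<^sub>- PuN D) \<Longrightarrow> derivable (\<langle>ShiftP (\<down>\<^sub>o B)\<rangle>\<^sub>+ \<turnstile>\<^sub>+ ShP (\<down>\<^sub>s D))"
| ton_up: "derivable (PuP X \<turnstile>\<^sub>+ PuP (FmP A)) \<Longrightarrow> derivable (ShN (\<up>\<^sub>s X) \<turnstile>\<^sub>- \<langle>ShiftN (\<up>\<^sub>o A)\<rangle>\<^sub>-)"


section \<open>Interpretation\<close>

text \<open>\<open>v\<close> and \<open>w\<close> are the values of the positive and of the negative atoms.\<close>

context
  fixes A :: "('p, 'sp, 'n, 'sn) lg_structure" and v :: "nat \<Rightarrow> 'p" and w :: "nat \<Rightarrow> 'n"
begin

primrec int_pos_fm :: "pos_fm \<Rightarrow> 'p" and int_neg_fm :: "neg_fm \<Rightarrow> 'n"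
  and int_spos_fm :: "spos_fm \<Rightarrow> 'sp" and int_sneg_fm :: "sneg_fm \<Rightarrow> 'sn"
  and int_gpos_fm :: "gpos_fm \<Rightarrow> 'p + 'sp" and int_gneg_fm :: "gneg_fm \<Rightarrow> 'n + 'sn" where
  "int_pos_fm (PAtom i) = v i"
| "int_pos_fm (a \<otimes>\<^sub>o b) = tens A (int_gpos_fm a) (int_gpos_fm b)"
| "int_pos_fm (a \<oslash>\<^sub>o b) = osl A (int_gpos_fm a) (int_gneg_fm b)"
| "int_pos_fm (a \<ominus>\<^sub>o b) = omin A (int_gneg_fm a) (int_gpos_fm b)"
| "int_neg_fm (NAtom i) = w i"
| "int_neg_fm (a \<oplus>\<^sub>o b) = opl A (int_gneg_fm a) (int_gneg_fm b)"
| "int_neg_fm (a \<setminus>\<^sub>o b) = bsl A (int_gpos_fm a) (int_gneg_fm b)"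
| "int_neg_fm (a /\<^sub>o b) = sla A (int_gneg_fm a) (int_gpos_fm b)"
| "int_spos_fm (\<down>\<^sub>o a) = down A (int_neg_fm a)"
| "int_sneg_fm (\<up>\<^sub>o a) = up A (int_pos_fm a)"
| "int_gpos_fm (PureP a) = Inl (int_pos_fm a)"
| "int_gpos_fm (ShiftP a) = Inr (int_spos_fm a)"
| "int_gneg_fm (PureN a) = Inl (int_neg_fm a)"
| "int_gneg_fm (ShiftN a) = Inr (int_sneg_fm a)"

primrec int_pos_st :: "pos_st \<Rightarrow> 'p" and int_neg_st :: "neg_st \<Rightarrow> 'n"
  and int_spos_st :: "spos_st \<Rightarrow> 'sp" and int_sneg_st :: "sneg_st \<Rightarrow> 'sn"
  and int_gpos_st :: "gpos_st \<Rightarrow> 'p + 'sp" and int_gneg_st :: "gneg_st \<Rightarrow> 'n + 'sn" where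
  "int_pos_st (FmP a) = int_pos_fm a"
| "int_pos_st (\<Down>\<^sub>s a) = ddown A (int_sneg_st a)"
| "int_pos_st (a \<otimes>\<^sub>s b) = tens A (int_gpos_st a) (int_gpos_st b)"
| "int_pos_st (a \<oslash>\<^sub>s b) = osl A (int_gpos_st a) (int_gneg_st b)"
| "int_pos_st (a \<ominus>\<^sub>s b) = omin A (int_gneg_st a) (int_gpos_st b)"
| "int_neg_st (FmN a) = int_neg_fm a"
| "int_neg_st (\<Up>\<^sub>s a) = uup A (int_spos_st a)"
| "int_neg_st (a \<oplus>\<^sub>s b) = opl A (int_gneg_st a) (int_gneg_st b)"
| "int_neg_st (a \<setminus>\<^sub>s b) = bsl A (int_gpos_st a) (int_gneg_st b)"
| "int_neg_st (a /\<^sub>s b) = sla A (int_gneg_st a) (int_gpos_st b)"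
| "int_spos_st (FmSP a) = int_spos_fm a"
| "int_spos_st (\<down>\<^sub>s a) = down A (int_neg_st a)"
| "int_spos_st (a \<oplus>\<^sub>l b) = opll A (int_gpos_st a) (int_gneg_st b)"
| "int_spos_st (a \<oplus>\<^sub>r b) = oplr A (int_gneg_st a) (int_gpos_st b)"
| "int_spos_st (a \<setminus>\<^sub>l b) = bsll A (int_gneg_st a) (int_gneg_st b)"
| "int_spos_st (a \<setminus>\<^sub>r b) = bslr A (int_gpos_st a) (int_gpos_st b)"
| "int_spos_st (a /\<^sub>l b) = slal A (int_gpos_st a) (int_gpos_st b)"
| "int_spos_st (a /\<^sub>r b) = slar A (int_gneg_st a) (int_gneg_st b)"
| "int_sneg_st (FmSN a) = int_sneg_fm a"
| "int_sneg_st (\<up>\<^sub>s a) = up A (int_pos_st a)"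
| "int_sneg_st (a \<otimes>\<^sub>l b) = tensl A (int_gneg_st a) (int_gpos_st b)"
| "int_sneg_st (a \<otimes>\<^sub>r b) = tensr A (int_gpos_st a) (int_gneg_st b)"
| "int_sneg_st (a \<oslash>\<^sub>l b) = osll A (int_gneg_st a) (int_gneg_st b)"
| "int_sneg_st (a \<oslash>\<^sub>r b) = oslr A (int_gpos_st a) (int_gpos_st b)"
| "int_sneg_st (a \<ominus>\<^sub>l b) = ominl A (int_gpos_st a) (int_gpos_st b)"
| "int_sneg_st (a \<ominus>\<^sub>r b) = ominr A (int_gneg_st a) (int_gneg_st b)"
| "int_gpos_st (PuP a) = Inl (int_pos_st a)"
| "int_gpos_st (ShP a) = Inr (int_spos_st a)"
| "int_gneg_st (PuN a) = Inl (int_neg_st a)"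
| "int_gneg_st (ShN a) = Inr (int_sneg_st a)"

fun holds :: "sequent \<Rightarrow> bool" where
  "holds (X \<turnstile>\<^sub>+ Y) \<longleftrightarrow> le_pos A (int_gpos_st X) (int_gpos_st Y)"
| "holds (G \<turnstile>\<^sub>- D) \<longleftrightarrow> le_neg A (int_gneg_st G) (int_gneg_st D)"
| "holds (X \<turnstile>\<^sub>0 D) \<longleftrightarrow> le_neut A (int_gpos_st X) (int_gneg_st D)"

end

text \<open>Elements are restricted to the type parameters of \<open>A\<close>, so \<open>valid_in A S\<close> for all \<open>A\<close> of a given
  type speaks about the algebras whose carriers embed into these types.  Every algebra is covered by
  choosing the types large enough; infinite types already contain all countable algebras.\<close>

definition valid_in :: "('p, 'sp, 'n, 'sn) lg_structure \<Rightarrow> sequent \<Rightarrow> bool" where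
  "valid_in A S \<longleftrightarrow>
     (\<forall>v w. (\<forall>i. v i \<in> carP A) \<longrightarrow> (\<forall>i. w i \<in> carN A) \<longrightarrow> holds A v w S)"


section \<open>Standard sequents\<close>

definition lift2 :: "('a \<Rightarrow> 'b \<Rightarrow> 'c) \<Rightarrow> 'a option \<Rightarrow> 'b option \<Rightarrow> 'c option" where
  "lift2 f x y = Option.bind x (\<lambda>a. map_option (f a) y)"

text \<open>Turn every connective into its operational counterpart; \<open>None\<close> if one has no such
  counterpart.\<close>

primrec oper_pos :: "pos_st \<Rightarrow> pos_fm option" and oper_neg :: "neg_st \<Rightarrow> neg_fm option"
  and oper_spos :: "spos_st \<Rightarrow> spos_fm option" and oper_sneg :: "sneg_st \<Rightarrow> sneg_fm option"
  and oper_gpos :: "gpos_st \<Rightarrow> gpos_fm option" and oper_gneg :: "gneg_st \<Rightarrow> gneg_fm option" where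
  "oper_pos (FmP a) = Some a"
| "oper_pos (\<Down>\<^sub>s a) = None"
| "oper_pos (a \<otimes>\<^sub>s b) = lift2 (\<otimes>\<^sub>o) (oper_gpos a) (oper_gpos b)"
| "oper_pos (a \<oslash>\<^sub>s b) = lift2 (\<oslash>\<^sub>o) (oper_gpos a) (oper_gneg b)"
| "oper_pos (a \<ominus>\<^sub>s b) = lift2 (\<ominus>\<^sub>o) (oper_gneg a) (oper_gpos b)"
| "oper_neg (FmN a) = Some a"
| "oper_neg (\<Up>\<^sub>s a) = None"
| "oper_neg (a \<oplus>\<^sub>s b) = lift2 (\<oplus>\<^sub>o) (oper_gneg a) (oper_gneg b)"
| "oper_neg (a \<setminus>\<^sub>s b) = lift2 (\<setminus>\<^sub>o) (oper_gpos a) (oper_gneg b)"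
| "oper_neg (a /\<^sub>s b) = lift2 (/\<^sub>o) (oper_gneg a) (oper_gpos b)"
| "oper_spos (FmSP a) = Some a"
| "oper_spos (\<down>\<^sub>s a) = map_option DownF (oper_neg a)"
| "oper_spos (a \<oplus>\<^sub>l b) = None"
| "oper_spos (a \<oplus>\<^sub>r b) = None"
| "oper_spos (a \<setminus>\<^sub>l b) = None"
| "oper_spos (a \<setminus>\<^sub>r b) = None"
| "oper_spos (a /\<^sub>l b) = None"
| "oper_spos (a /\<^sub>r b) = None"
| "oper_sneg (FmSN a) = Some a"
| "oper_sneg (\<up>\<^sub>s a) = map_option UpF (oper_pos a)"
| "oper_sneg (a \<otimes>\<^sub>l b) = None"
| "oper_sneg (a \<otimes>\<^sub>r b) = None"
| "oper_sneg (a \<oslash>\<^sub>l b) = None"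
| "oper_sneg (a \<oslash>\<^sub>r b) = None"
| "oper_sneg (a \<ominus>\<^sub>l b) = None"
| "oper_sneg (a \<ominus>\<^sub>r b) = None"
| "oper_gpos (PuP a) = map_option PureP (oper_pos a)"
| "oper_gpos (ShP a) = map_option ShiftP (oper_spos a)"
| "oper_gneg (PuN a) = map_option PureN (oper_neg a)"
| "oper_gneg (ShN a) = map_option ShiftN (oper_sneg a)"

datatype sign = Plus | Minus

fun opp :: "sign \<Rightarrow> sign" where
  "opp Plus = Minus"
| "opp Minus = Plus"

datatype family = FConn | GConn

fun skeleton :: "sign \<Rightarrow> family \<Rightarrow> bool" where
  "skeleton Plus FConn \<longleftrightarrow> True"
| "skeleton Minus GConn \<longleftrightarrow> True"
| "skeleton Plus GConn \<longleftrightarrow> False"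
| "skeleton Minus FConn \<longleftrightarrow> False"

text \<open>
  Standardisation of the signed generation tree with root sign \<open>s\<close>.  If the root is a skeleton
  node, the connectives of the principal subtree, i.e. those reachable from the root through
  skeleton nodes only, become structural, and the subtrees starting at the first PIA nodes become
  operational.  If the root is a PIA node, the principal subtree becomes operational, and so does
  everything below it.  In both cases a node met with only skeleton ancestors is made structural if
  it is skeleton, and otherwise its whole subtree is made operational, which gives the recursion
  below.  The syntax tree includes the connectives inside formulas, so these may become structural
  as well.  On formulas the result is always defined.
\<close>

primrec std_pos_fm :: "sign \<Rightarrow> pos_fm \<Rightarrow> pos_st" and std_neg_fm :: "sign \<Rightarrow> neg_fm \<Rightarrow> neg_st"
  and std_spos_fm :: "sign \<Rightarrow> spos_fm \<Rightarrow> spos_st" and std_sneg_fm :: "sign \<Rightarrow> sneg_fm \<Rightarrow> sneg_st"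
  and std_gpos_fm :: "sign \<Rightarrow> gpos_fm \<Rightarrow> gpos_st" and std_gneg_fm :: "sign \<Rightarrow> gneg_fm \<Rightarrow> gneg_st" where
  "std_pos_fm s (PAtom i) = FmP (PAtom i)"
| "std_pos_fm s (a \<otimes>\<^sub>o b) =
    (if skeleton s FConn then std_gpos_fm s a \<otimes>\<^sub>s std_gpos_fm s b else FmP (a \<otimes>\<^sub>o b))"
| "std_pos_fm s (a \<oslash>\<^sub>o b) =
    (if skeleton s FConn then std_gpos_fm s a \<oslash>\<^sub>s std_gneg_fm (opp s) b else FmP (a \<oslash>\<^sub>o b))"
| "std_pos_fm s (a \<ominus>\<^sub>o b) =
    (if skeleton s FConn then std_gneg_fm (opp s) a \<ominus>\<^sub>s std_gpos_fm s b else FmP (a \<ominus>\<^sub>o b))"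
| "std_neg_fm s (NAtom i) = FmN (NAtom i)"
| "std_neg_fm s (a \<oplus>\<^sub>o b) =
    (if skeleton s GConn then std_gneg_fm s a \<oplus>\<^sub>s std_gneg_fm s b else FmN (a \<oplus>\<^sub>o b))"
| "std_neg_fm s (a \<setminus>\<^sub>o b) =
    (if skeleton s GConn then std_gpos_fm (opp s) a \<setminus>\<^sub>s std_gneg_fm s b else FmN (a \<setminus>\<^sub>o b))"
| "std_neg_fm s (a /\<^sub>o b) =
    (if skeleton s GConn then std_gneg_fm s a /\<^sub>s std_gpos_fm (opp s) b else FmN (a /\<^sub>o b))"
| "std_spos_fm s (\<down>\<^sub>o a) = (if skeleton s GConn then \<down>\<^sub>s (std_neg_fm s a) else FmSP (\<down>\<^sub>o a))"
| "std_sneg_fm s (\<up>\<^sub>o a) = (if skeleton s FConn then \<up>\<^sub>s (std_pos_fm s a) else FmSN (\<up>\<^sub>o a))"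
| "std_gpos_fm s (PureP a) = PuP (std_pos_fm s a)"
| "std_gpos_fm s (ShiftP a) = ShP (std_spos_fm s a)"
| "std_gneg_fm s (PureN a) = PuN (std_neg_fm s a)"
| "std_gneg_fm s (ShiftN a) = ShN (std_sneg_fm s a)"

primrec std_pos :: "sign \<Rightarrow> pos_st \<Rightarrow> pos_st option"
  and std_neg :: "sign \<Rightarrow> neg_st \<Rightarrow> neg_st option"
  and std_spos :: "sign \<Rightarrow> spos_st \<Rightarrow> spos_st option"
  and std_sneg :: "sign \<Rightarrow> sneg_st \<Rightarrow> sneg_st option"
  and std_gpos :: "sign \<Rightarrow> gpos_st \<Rightarrow> gpos_st option"
  and std_gneg :: "sign \<Rightarrow> gneg_st \<Rightarrow> gneg_st option" where
  "std_pos s (FmP a) = Some (std_pos_fm s a)"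
| "std_pos s (\<Down>\<^sub>s a) =
    (if skeleton s GConn then map_option DDown (std_sneg s a)
     else map_option FmP (oper_pos (\<Down>\<^sub>s a)))"
| "std_pos s (a \<otimes>\<^sub>s b) =
    (if skeleton s FConn then lift2 (\<otimes>\<^sub>s) (std_gpos s a) (std_gpos s b)
     else map_option FmP (oper_pos (a \<otimes>\<^sub>s b)))"
| "std_pos s (a \<oslash>\<^sub>s b) =
    (if skeleton s FConn then lift2 (\<oslash>\<^sub>s) (std_gpos s a) (std_gneg (opp s) b)
     else map_option FmP (oper_pos (a \<oslash>\<^sub>s b)))"
| "std_pos s (a \<ominus>\<^sub>s b) =
    (if skeleton s FConn then lift2 (\<ominus>\<^sub>s) (std_gneg (opp s) a) (std_gpos s b)
     else map_option FmP (oper_pos (a \<ominus>\<^sub>s b)))"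
| "std_neg s (FmN a) = Some (std_neg_fm s a)"
| "std_neg s (\<Up>\<^sub>s a) =
    (if skeleton s FConn then map_option UUp (std_spos s a)
     else map_option FmN (oper_neg (\<Up>\<^sub>s a)))"
| "std_neg s (a \<oplus>\<^sub>s b) =
    (if skeleton s GConn then lift2 (\<oplus>\<^sub>s) (std_gneg s a) (std_gneg s b)
     else map_option FmN (oper_neg (a \<oplus>\<^sub>s b)))"
| "std_neg s (a \<setminus>\<^sub>s b) =
    (if skeleton s GConn then lift2 (\<setminus>\<^sub>s) (std_gpos (opp s) a) (std_gneg s b)
     else map_option FmN (oper_neg (a \<setminus>\<^sub>s b)))"
| "std_neg s (a /\<^sub>s b) =
    (if skeleton s GConn then lift2 (/\<^sub>s) (std_gneg s a) (std_gpos (opp s) b)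
     else map_option FmN (oper_neg (a /\<^sub>s b)))"
| "std_spos s (FmSP a) = Some (std_spos_fm s a)"
| "std_spos s (\<down>\<^sub>s a) =
    (if skeleton s GConn then map_option Down (std_neg s a)
     else map_option FmSP (oper_spos (\<down>\<^sub>s a)))"
| "std_spos s (a \<oplus>\<^sub>l b) =
    (if skeleton s GConn then lift2 (\<oplus>\<^sub>l) (std_gpos s a) (std_gneg s b)
     else map_option FmSP (oper_spos (a \<oplus>\<^sub>l b)))"
| "std_spos s (a \<oplus>\<^sub>r b) =
    (if skeleton s GConn then lift2 (\<oplus>\<^sub>r) (std_gneg s a) (std_gpos s b)
     else map_option FmSP (oper_spos (a \<oplus>\<^sub>r b)))"
| "std_spos s (a \<setminus>\<^sub>l b) =
    (if skeleton s GConn then lift2 (\<setminus>\<^sub>l) (std_gneg (opp s) a) (std_gneg s b)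
     else map_option FmSP (oper_spos (a \<setminus>\<^sub>l b)))"
| "std_spos s (a \<setminus>\<^sub>r b) =
    (if skeleton s GConn then lift2 (\<setminus>\<^sub>r) (std_gpos (opp s) a) (std_gpos s b)
     else map_option FmSP (oper_spos (a \<setminus>\<^sub>r b)))"
| "std_spos s (a /\<^sub>l b) =
    (if skeleton s GConn then lift2 (/\<^sub>l) (std_gpos s a) (std_gpos (opp s) b)
     else map_option FmSP (oper_spos (a /\<^sub>l b)))"
| "std_spos s (a /\<^sub>r b) =
    (if skeleton s GConn then lift2 (/\<^sub>r) (std_gneg s a) (std_gneg (opp s) b)
     else map_option FmSP (oper_spos (a /\<^sub>r b)))"
| "std_sneg s (FmSN a) = Some (std_sneg_fm s a)"
| "std_sneg s (\<up>\<^sub>s a) =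
    (if skeleton s FConn then map_option Up (std_pos s a)
     else map_option FmSN (oper_sneg (\<up>\<^sub>s a)))"
| "std_sneg s (a \<otimes>\<^sub>l b) =
    (if skeleton s FConn then lift2 (\<otimes>\<^sub>l) (std_gneg s a) (std_gpos s b)
     else map_option FmSN (oper_sneg (a \<otimes>\<^sub>l b)))"
| "std_sneg s (a \<otimes>\<^sub>r b) =
    (if skeleton s FConn then lift2 (\<otimes>\<^sub>r) (std_gpos s a) (std_gneg s b)
     else map_option FmSN (oper_sneg (a \<otimes>\<^sub>r b)))"
| "std_sneg s (a \<oslash>\<^sub>l b) =
    (if skeleton s FConn then lift2 (\<oslash>\<^sub>l) (std_gneg s a) (std_gneg (opp s) b)
     else map_option FmSN (oper_sneg (a \<oslash>\<^sub>l b)))"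
| "std_sneg s (a \<oslash>\<^sub>r b) =
    (if skeleton s FConn then lift2 (\<oslash>\<^sub>r) (std_gpos s a) (std_gpos (opp s) b)
     else map_option FmSN (oper_sneg (a \<oslash>\<^sub>r b)))"
| "std_sneg s (a \<ominus>\<^sub>l b) =
    (if skeleton s FConn then lift2 (\<ominus>\<^sub>l) (std_gpos (opp s) a) (std_gpos s b)
     else map_option FmSN (oper_sneg (a \<ominus>\<^sub>l b)))"
| "std_sneg s (a \<ominus>\<^sub>r b) =
    (if skeleton s FConn then lift2 (\<ominus>\<^sub>r) (std_gneg (opp s) a) (std_gneg s b)
     else map_option FmSN (oper_sneg (a \<ominus>\<^sub>r b)))"
| "std_gpos s (PuP a) = map_option PuP (std_pos s a)"
| "std_gpos s (ShP a) = map_option ShP (std_spos s a)"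
| "std_gneg s (PuN a) = map_option PuN (std_neg s a)"
| "std_gneg s (ShN a) = map_option ShN (std_sneg s a)"

fun standard_sequent :: "sequent \<Rightarrow> sequent option" where
  "standard_sequent (X \<turnstile>\<^sub>+ Y) = lift2 (\<turnstile>\<^sub>+) (std_gpos Plus X) (std_gpos Minus Y)"
| "standard_sequent (G \<turnstile>\<^sub>- D) = lift2 (\<turnstile>\<^sub>-) (std_gneg Plus G) (std_gneg Minus D)"
| "standard_sequent (X \<turnstile>\<^sub>0 D) = lift2 (\<turnstile>\<^sub>0) (std_gpos Plus X) (std_gneg Minus D)"

end

theory Submission
  imports Defs "HOL-Library.Countable_Set"
begin

text \<open>
  Derivability is a polarity between antecedents and succedents: take as pure positive elements the
  sets of pure positive structures that are Galois closed with respect to all positive succedents,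
  as shifted positive elements the sets of positive structures that are Galois closed with respect
  to the shifted succedents only, and dually for the negative sorts.  By the display postulates
  these sets form a fully polarized LG-algebra; neither identity nor cut for structures is needed.
  Interpret each positive atom by the pure structures that derive it, and dually each negative atom.
  Then the standardised left-hand side of a sequent belongs to its own interpretation, and the
  standardised right-hand side is derivable from all members of its interpretation; hence validity
  of the sequent gives derivability of its standard form.

  The translation rules are only available for neutral sequents, so identity for a pure compound
  formula has to be replaced by \<open>P \<otimes>\<^sub>s Q \<turnstile>\<^sub>+ P \<otimes> Q\<close>; this is where standardisation enters.

  The given types are only known to be infinite, but all operations exist as structural
  connectives, so the values of structures form a countable subalgebra, which can be copied into
  these types.
\<close>

section \<open>The canonical algebra\<close>

lemma derivable_iff: "S \<rightleftharpoons> T \<Longrightarrow> derivable S \<longleftrightarrow> derivable T"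
  by (blast intro: inv_fwd inv_bwd)

lemmas display = invertible_rule.intros[THEN derivable_iff]

text \<open>Both sides are equivalent to the positive sequent with succedent
  \<open>\<down>\<^sub>s D\<close>. With \<open>derivable_ddown\<close> this lets neutral sequents
  be read as tests of a single polarity.\<close>

lemma derivable_uup: "derivable (ShP X \<turnstile>\<^sub>0 PuN D) \<longleftrightarrow> derivable (PuN (\<Up>\<^sub>s X) \<turnstile>\<^sub>- PuN D)"
  by (simp add: display(19,20))

lemma derivable_ddown: "derivable (PuP X \<turnstile>\<^sub>0 ShN D) \<longleftrightarrow> derivable (PuP X \<turnstile>\<^sub>+ PuP (\<Down>\<^sub>s D))"
  by (simp add: display(17,21))

definition clP :: "pos_st set \<Rightarrow> pos_st set" where
  "clP S = {X. \<forall>Y. (\<forall>Z\<in>S. derivable (PuP Z \<turnstile>\<^sub>+ Y)) \<longrightarrow> derivable (PuP X \<turnstile>\<^sub>+ Y)}"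

text \<open>Elements of a dotted sort collect structures of both positive sorts, so that the
  pure-to-shifted part of the order is again an inclusion. Fewer tests make closedness stronger; the
  residuals still satisfy it, since displaying them ends in a shifted succedent.\<close>

definition clSP :: "gpos_st set \<Rightarrow> gpos_st set" where
  "clSP S = {X. \<forall>Y. (\<forall>Z\<in>S. derivable (Z \<turnstile>\<^sub>+ ShP Y)) \<longrightarrow> derivable (X \<turnstile>\<^sub>+ ShP Y)}"

text \<open>Negative elements are sets of succedents, tested by antecedents; hence a larger element
  is a smaller set.\<close>

definition clN :: "neg_st set \<Rightarrow> neg_st set" where
  "clN S = {D. \<forall>G. (\<forall>Z\<in>S. derivable (G \<turnstile>\<^sub>- PuN Z)) \<longrightarrow> derivable (G \<turnstile>\<^sub>- PuN D)}"

definition clSN :: "gneg_st set \<Rightarrow> gneg_st set" where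
  "clSN S = {D. \<forall>G. (\<forall>Z\<in>S. derivable (ShN G \<turnstile>\<^sub>- Z)) \<longrightarrow> derivable (ShN G \<turnstile>\<^sub>- D)}"

text \<open>A common home for both sorts of a ringed carrier: the binary operations of the canonical
  algebra depend on their arguments through \<open>low\<close> and \<open>upp\<close> only.\<close>

fun low :: "pos_st set + gpos_st set \<Rightarrow> gpos_st set" where
  "low (Inl S) = PuP ` S"
| "low (Inr S) = S"

fun upp :: "neg_st set + gneg_st set \<Rightarrow> gneg_st set" where
  "upp (Inl S) = PuN ` S"
| "upp (Inr S) = S"

text \<open>Each variant is the residual dictated by the pure connective with which it shares a display
  postulate.\<close>

definition canonical :: "(pos_st set, gpos_st set, neg_st set, gneg_st set) lg_structure" where
  "canonical = \<lparr>
    carP = {S. clP S \<subseteq> S}, carSP = {S. clSP S \<subseteq> S},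
    carN = {S. clN S \<subseteq> S}, carSN = {S. clSN S \<subseteq> S},
    leP = (\<subseteq>), leSP = (\<subseteq>), leN = (\<supseteq>), leSN = (\<supseteq>),
    up = \<lambda>a. {D. \<forall>X\<in>a. derivable (PuP X \<turnstile>\<^sub>0 D)},
    ddown = \<lambda>b. {X. \<forall>D\<in>b. derivable (PuP X \<turnstile>\<^sub>0 D)},
    uup = \<lambda>a. {D. \<forall>X\<in>a. derivable (X \<turnstile>\<^sub>0 PuN D)},
    down = \<lambda>b. {X. \<forall>D\<in>b. derivable (X \<turnstile>\<^sub>0 PuN D)},
    relPos = \<lambda>a b. PuP ` a \<subseteq> b,
    relNeut = \<lambda>a b. \<forall>X\<in>a. \<forall>D\<in>b. derivable (PuP X \<turnstile>\<^sub>0 PuN D),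
    relNeg = \<lambda>a b. PuN ` b \<subseteq> a,
    tens = \<lambda>P Q. clP {X \<otimes>\<^sub>s Y |X Y. X \<in> low P \<and> Y \<in> low Q},
    osl = \<lambda>P N. clP {X \<oslash>\<^sub>s D |X D. X \<in> low P \<and> D \<in> upp N},
    omin = \<lambda>N P. clP {D \<ominus>\<^sub>s X |D X. D \<in> upp N \<and> X \<in> low P},
    opl = \<lambda>M N. clN {G \<oplus>\<^sub>s D |G D. G \<in> upp M \<and> D \<in> upp N},
    bsl = \<lambda>P N. clN {X \<setminus>\<^sub>s D |X D. X \<in> low P \<and> D \<in> upp N},
    sla = \<lambda>N P. clN {D /\<^sub>s X |D X. D \<in> upp N \<and> X \<in> low P},
    tensl = \<lambda>L Q. {D. \<forall>X\<in>low Q. PuN (D /\<^sub>s X) \<in> upp L},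
    osll = \<lambda>L N. {G. \<forall>D\<in>upp N. PuN (G \<oplus>\<^sub>s D) \<in> upp L},
    ominl = \<lambda>R P. {D. \<forall>X\<in>low P. PuP (X \<oslash>\<^sub>s D) \<in> low R},
    opll = \<lambda>R N. {X. \<forall>D\<in>upp N. PuP (X \<oslash>\<^sub>s D) \<in> low R},
    bsll = \<lambda>L N. {X. \<forall>D\<in>upp N. PuN (D /\<^sub>s X) \<in> upp L},
    slal = \<lambda>R Q. {X. \<forall>Y\<in>low Q. PuP (X \<otimes>\<^sub>s Y) \<in> low R},
    tensr = \<lambda>P L. {D. \<forall>X\<in>low P. PuN (X \<setminus>\<^sub>s D) \<in> upp L},
    oslr = \<lambda>P R. {G. \<forall>X\<in>low P. PuP (G \<ominus>\<^sub>s X) \<in> low R},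
    ominr = \<lambda>M L. {D. \<forall>G\<in>upp M. PuN (G \<oplus>\<^sub>s D) \<in> upp L},
    oplr = \<lambda>M R. {X. \<forall>D\<in>upp M. PuP (D \<ominus>\<^sub>s X) \<in> low R},
    bslr = \<lambda>P R. {Y. \<forall>X\<in>low P. PuP (X \<otimes>\<^sub>s Y) \<in> low R},
    slar = \<lambda>N L. {X. \<forall>D\<in>upp N. PuN (X \<setminus>\<^sub>s D) \<in> upp L}\<rparr>"

lemma canonical_simps [simp]:
  "carP canonical = {S. clP S \<subseteq> S}" "carSP canonical = {S. clSP S \<subseteq> S}"
  "carN canonical = {S. clN S \<subseteq> S}" "carSN canonical = {S. clSN S \<subseteq> S}"
  "leP canonical = (\<subseteq>)" "leSP canonical = (\<subseteq>)" "leN canonical = (\<supseteq>)" "leSN canonical = (\<supseteq>)"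
  "up canonical a = {D. \<forall>X\<in>a. derivable (PuP X \<turnstile>\<^sub>0 D)}"
  "ddown canonical d = {X. \<forall>D\<in>d. derivable (PuP X \<turnstile>\<^sub>0 D)}"
  "uup canonical b = {D. \<forall>X\<in>b. derivable (X \<turnstile>\<^sub>0 PuN D)}"
  "down canonical c = {X. \<forall>D\<in>c. derivable (X \<turnstile>\<^sub>0 PuN D)}"
  "relPos canonical a b \<longleftrightarrow> PuP ` a \<subseteq> b"
  "relNeut canonical a c \<longleftrightarrow> (\<forall>X\<in>a. \<forall>D\<in>c. derivable (PuP X \<turnstile>\<^sub>0 PuN D))"
  "relNeg canonical d c \<longleftrightarrow> PuN ` c \<subseteq> d"
  "tens canonical P Q = clP {X \<otimes>\<^sub>s Y |X Y. X \<in> low P \<and> Y \<in> low Q}"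
  "osl canonical P N = clP {X \<oslash>\<^sub>s D |X D. X \<in> low P \<and> D \<in> upp N}"
  "omin canonical N P = clP {D \<ominus>\<^sub>s X |D X. D \<in> upp N \<and> X \<in> low P}"
  "opl canonical M N = clN {G \<oplus>\<^sub>s D |G D. G \<in> upp M \<and> D \<in> upp N}"
  "bsl canonical P N = clN {X \<setminus>\<^sub>s D |X D. X \<in> low P \<and> D \<in> upp N}"
  "sla canonical N P = clN {D /\<^sub>s X |D X. D \<in> upp N \<and> X \<in> low P}"
  "tensl canonical L Q = {D. \<forall>X\<in>low Q. PuN (D /\<^sub>s X) \<in> upp L}"
  "osll canonical L N = {G. \<forall>D\<in>upp N. PuN (G \<oplus>\<^sub>s D) \<in> upp L}"
  "ominl canonical R P = {D. \<forall>X\<in>low P. PuP (X \<oslash>\<^sub>s D) \<in> low R}"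
  "opll canonical R N = {X. \<forall>D\<in>upp N. PuP (X \<oslash>\<^sub>s D) \<in> low R}"
  "bsll canonical L N = {X. \<forall>D\<in>upp N. PuN (D /\<^sub>s X) \<in> upp L}"
  "slal canonical R Q = {X. \<forall>Y\<in>low Q. PuP (X \<otimes>\<^sub>s Y) \<in> low R}"
  "tensr canonical P L = {D. \<forall>X\<in>low P. PuN (X \<setminus>\<^sub>s D) \<in> upp L}"
  "oslr canonical P R = {G. \<forall>X\<in>low P. PuP (G \<ominus>\<^sub>s X) \<in> low R}"
  "ominr canonical M L = {D. \<forall>G\<in>upp M. PuN (G \<oplus>\<^sub>s D) \<in> upp L}"
  "oplr canonical M R = {X. \<forall>D\<in>upp M. PuP (D \<ominus>\<^sub>s X) \<in> low R}"
  "bslr canonical P R = {Y. \<forall>X\<in>low P. PuP (X \<otimes>\<^sub>s Y) \<in> low R}"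
  "slar canonical N L = {X. \<forall>D\<in>upp N. PuN (X \<setminus>\<^sub>s D) \<in> upp L}"
  by (simp_all add: canonical_def)

lemma clP_extensive: "S \<subseteq> clP S"
  by (auto simp: clP_def)

lemma clN_extensive: "S \<subseteq> clN S"
  by (auto simp: clN_def)

lemma clP_idem: "clP (clP S) \<subseteq> clP S"
  by (auto simp: clP_def)

lemma clN_idem: "clN (clN S) \<subseteq> clN S"
  by (auto simp: clN_def)

lemma clP_mono: "S \<subseteq> T \<Longrightarrow> clP S \<subseteq> clP T"
  unfolding clP_def by blast

lemma clN_mono: "S \<subseteq> T \<Longrightarrow> clN S \<subseteq> clN T"
  unfolding clN_def by blast

text \<open>The premise ranges over all succedents, hence covers the tests of both closures: those
  of \<open>clP\<close> for a pure element and the shifted ones of \<open>clSP\<close> for a shifted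
  element.\<close>

lemma low_closedI:
  assumes "P \<in> gcarP canonical"
    and "\<And>Z. (\<And>W. W \<in> low P \<Longrightarrow> derivable (W \<turnstile>\<^sub>+ Z)) \<Longrightarrow> derivable (PuP X \<turnstile>\<^sub>+ Z)"
  shows "PuP X \<in> low P"
  using assms by (cases P) (fastforce simp: gcarP_def clP_def clSP_def)+

lemma upp_closedI:
  assumes "N \<in> gcarN canonical"
    and "\<And>Z. (\<And>D. D \<in> upp N \<Longrightarrow> derivable (Z \<turnstile>\<^sub>- D)) \<Longrightarrow> derivable (Z \<turnstile>\<^sub>- PuN G)"
  shows "PuN G \<in> upp N"
  using assms by (cases N) (fastforce simp: gcarN_def clN_def clSN_def)+

section \<open>Order relations of the canonical algebra\<close>

lemma le_pos_low: "le_pos canonical x y \<Longrightarrow> low x \<subseteq> low y"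
  by (cases x; cases y) auto

lemma le_neg_upp: "le_neg canonical m n \<Longrightarrow> upp n \<subseteq> upp m"
  by (cases m; cases n) auto

lemma le_neut_derivable:
  "le_neut canonical x n \<Longrightarrow> X \<in> low x \<Longrightarrow> D \<in> upp n \<Longrightarrow> derivable (X \<turnstile>\<^sub>0 D)"
  by (cases x; cases n) auto

text \<open>With a shifted right-hand side inclusion also suffices; in general it does not, because
  \<open>le_pos\<close> is false from shifted to pure whatever the sets are.\<close>

lemma le_pos_shifted: "le_pos canonical x (Inr T) \<longleftrightarrow> low x \<subseteq> T"
  by (cases x) auto

lemma le_neg_shifted: "le_neg canonical (Inr T) n \<longleftrightarrow> upp n \<subseteq> T"
  by (cases n) auto

text \<open>The closure is the least closed set above its generators, and \<open>low_closedI\<close>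
  makes every ringed element closed enough. Comparisons with a product thus reduce to its
  generators.\<close>

lemma le_pos_clP:
  assumes "y \<in> gcarP canonical"
  shows "le_pos canonical (Inl (clP S)) y \<longleftrightarrow> PuP ` S \<subseteq> low y"
proof
  show "PuP ` S \<subseteq> low y" if "le_pos canonical (Inl (clP S)) y"
    using le_pos_low[OF that] clP_extensive[of S] by auto
next
  assume S: "PuP ` S \<subseteq> low y"
  have "PuP X \<in> low y" if "X \<in> clP S" for X
    using that S by (intro low_closedI[OF assms]) (auto simp: clP_def)
  then show "le_pos canonical (Inl (clP S)) y"
    by (cases y) auto
qed

lemma le_neg_clN:
  assumes "m \<in> gcarN canonical"
  shows "le_neg canonical m (Inl (clN S)) \<longleftrightarrow> PuN ` S \<subseteq> upp m"
proof
  show "PuN ` S \<subseteq> upp m" if "le_neg canonical m (Inl (clN S))"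
    using le_neg_upp[OF that] clN_extensive[of S] by auto
next
  assume S: "PuN ` S \<subseteq> upp m"
  have "PuN X \<in> upp m" if "X \<in> clN S" for X
    using that S by (intro upp_closedI[OF assms]) (auto simp: clN_def)
  then show "le_neg canonical m (Inl (clN S))"
    by (cases m) auto
qed

text \<open>A neutral sequent with fixed succedent amounts to one of the tests that define
  \<open>clP\<close>, so closing a set cannot break it.\<close>

lemma neut_clP: "(\<forall>X\<in>clP S. derivable (PuP X \<turnstile>\<^sub>0 D)) \<longleftrightarrow> (\<forall>X\<in>S. derivable (PuP X \<turnstile>\<^sub>0 D))"
proof -
  \<comment> \<open>The test is \<open>\<down>\<^sub>s\<close> of a pure \<open>D\<close> and
    \<open>\<Down>\<^sub>s\<close> of a shifted one.\<close>
  have "\<exists>Y. \<forall>X. derivable (PuP X \<turnstile>\<^sub>0 D) \<longleftrightarrow> derivable (PuP X \<turnstile>\<^sub>+ Y)"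
    by (cases D) (auto simp: derivable_ddown display(20))
  then obtain Y where "\<And>X. derivable (PuP X \<turnstile>\<^sub>0 D) \<longleftrightarrow> derivable (PuP X \<turnstile>\<^sub>+ Y)"
    by blast
  then show ?thesis
    using clP_extensive[of S] by (auto simp: clP_def)
qed

lemma neut_clN: "(\<forall>D\<in>clN S. derivable (X \<turnstile>\<^sub>0 PuN D)) \<longleftrightarrow> (\<forall>D\<in>S. derivable (X \<turnstile>\<^sub>0 PuN D))"
proof -
  \<comment> \<open>Dually, \<open>\<up>\<^sub>s\<close> serves for a pure \<open>X\<close> and
    \<open>\<Up>\<^sub>s\<close> for a shifted one.\<close>
  have "\<exists>G. \<forall>D. derivable (X \<turnstile>\<^sub>0 PuN D) \<longleftrightarrow> derivable (G \<turnstile>\<^sub>- PuN D)"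
    by (cases X) (auto simp: derivable_uup display(21))
  then obtain G where "\<And>D. derivable (X \<turnstile>\<^sub>0 PuN D) \<longleftrightarrow> derivable (G \<turnstile>\<^sub>- PuN D)"
    by blast
  then show ?thesis
    using clN_extensive[of S] by (auto simp: clN_def)
qed

lemma le_neut_clP:
  "le_neut canonical (Inl (clP S)) n \<longleftrightarrow> (\<forall>X\<in>S. \<forall>D\<in>upp n. derivable (PuP X \<turnstile>\<^sub>0 D))"
  using neut_clP[of S] by (cases n) (auto simp: subset_iff; blast)+

lemma le_neut_clN:
  "le_neut canonical x (Inl (clN S)) \<longleftrightarrow> (\<forall>X\<in>low x. \<forall>D\<in>S. derivable (X \<turnstile>\<^sub>0 PuN D))"
  using neut_clN[of S] by (cases x) (auto simp: subset_iff; blast)+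

section \<open>Closedness of the shifts and the variants\<close>

lemma clSP_closedI:
  assumes "\<And>X. (\<And>Y. (\<And>Z. Z \<in> S \<Longrightarrow> derivable (Z \<turnstile>\<^sub>+ ShP Y)) \<Longrightarrow> derivable (X \<turnstile>\<^sub>+ ShP Y)) \<Longrightarrow> X \<in> S"
  shows "clSP S \<subseteq> S"
  using assms unfolding clSP_def by blast

lemma clSN_closedI:
  assumes "\<And>D. (\<And>G. (\<And>Z. Z \<in> S \<Longrightarrow> derivable (ShN G \<turnstile>\<^sub>- Z)) \<Longrightarrow> derivable (ShN G \<turnstile>\<^sub>- D)) \<Longrightarrow> D \<in> S"
  shows "clSN S \<subseteq> S"
  using assms unfolding clSN_def by blast

text \<open>Each set is an intersection of tests. For the shifted sorts the neutral sequents turn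
  into ones with antecedent \<open>\<up>\<^sub>s X\<close> or succedent
  \<open>\<down>\<^sub>s D\<close>; for the pure sorts \<open>neut_clP\<close> and
  \<open>neut_clN\<close> apply.\<close>

lemma canonical_shifts_closed:
  "clSN {D. \<forall>X\<in>a. derivable (PuP X \<turnstile>\<^sub>0 D)} \<subseteq> {D. \<forall>X\<in>a. derivable (PuP X \<turnstile>\<^sub>0 D)}"
  "clP {X. \<forall>D\<in>d. derivable (PuP X \<turnstile>\<^sub>0 D)} \<subseteq> {X. \<forall>D\<in>d. derivable (PuP X \<turnstile>\<^sub>0 D)}"
  "clN {D. \<forall>X\<in>b. derivable (X \<turnstile>\<^sub>0 PuN D)} \<subseteq> {D. \<forall>X\<in>b. derivable (X \<turnstile>\<^sub>0 PuN D)}"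
  "clSP {X. \<forall>D\<in>c. derivable (X \<turnstile>\<^sub>0 PuN D)} \<subseteq> {X. \<forall>D\<in>c. derivable (X \<turnstile>\<^sub>0 PuN D)}"
proof -
  show "clSN {D. \<forall>X\<in>a. derivable (PuP X \<turnstile>\<^sub>0 D)} \<subseteq> {D. \<forall>X\<in>a. derivable (PuP X \<turnstile>\<^sub>0 D)}"
    by (rule clSN_closedI) (simp add: display(21))
  show "clP {X. \<forall>D\<in>d. derivable (PuP X \<turnstile>\<^sub>0 D)} \<subseteq> {X. \<forall>D\<in>d. derivable (PuP X \<turnstile>\<^sub>0 D)}"
    using neut_clP by blast
  show "clN {D. \<forall>X\<in>b. derivable (X \<turnstile>\<^sub>0 PuN D)} \<subseteq> {D. \<forall>X\<in>b. derivable (X \<turnstile>\<^sub>0 PuN D)}"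
    using neut_clN by blast
  show "clSP {X. \<forall>D\<in>c. derivable (X \<turnstile>\<^sub>0 PuN D)} \<subseteq> {X. \<forall>D\<in>c. derivable (X \<turnstile>\<^sub>0 PuN D)}"
    by (rule clSP_closedI) (simp add: display(20))
qed

text \<open>\<open>f i X\<close> stands for a pure compound of \<open>X\<close> with a second
  argument \<open>i\<close>, and \<open>g i Z\<close> for what remains on the right when
  \<open>X\<close> is displayed. A test passed by all of \<open>low R\<close> becomes, through
  \<open>g\<close>, a shifted test passed by the whole residual, hence by every member of its
  closure. In the next three lemmas the displayed argument, the element \<open>R\<close>, or both
  become negative.\<close>

lemma clSP_residual_low:
  assumes "R \<in> gcarP canonical"
    and "\<And>i X Z. derivable (PuP (f i X) \<turnstile>\<^sub>+ Z) \<longleftrightarrow> derivable (X \<turnstile>\<^sub>+ ShP (g i Z))"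
  shows "clSP {X. \<forall>i\<in>I. PuP (f i X) \<in> low R} \<subseteq> {X. \<forall>i\<in>I. PuP (f i X) \<in> low R}"
proof (rule clSP_closedI, intro CollectI ballI)
  fix x i
  assume x: "\<And>Y. (\<And>W. W \<in> {X. \<forall>i\<in>I. PuP (f i X) \<in> low R} \<Longrightarrow> derivable (W \<turnstile>\<^sub>+ ShP Y)) \<Longrightarrow>
      derivable (x \<turnstile>\<^sub>+ ShP Y)" and i: "i \<in> I"
  show "PuP (f i x) \<in> low R"
  proof (rule low_closedI[OF assms(1)])
    fix Z
    assume Z: "\<And>W. W \<in> low R \<Longrightarrow> derivable (W \<turnstile>\<^sub>+ Z)"
    have "derivable (x \<turnstile>\<^sub>+ ShP (g i Z))"
      by (rule x) (auto simp flip: assms(2) intro: Z i)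
    then show "derivable (PuP (f i x) \<turnstile>\<^sub>+ Z)"
      by (simp add: assms(2))
  qed
qed

lemma clSN_residual_low:
  assumes "R \<in> gcarP canonical"
    and "\<And>i D Z. derivable (PuP (f i D) \<turnstile>\<^sub>+ Z) \<longleftrightarrow> derivable (ShN (g i Z) \<turnstile>\<^sub>- D)"
  shows "clSN {D. \<forall>i\<in>I. PuP (f i D) \<in> low R} \<subseteq> {D. \<forall>i\<in>I. PuP (f i D) \<in> low R}"
proof (rule clSN_closedI, intro CollectI ballI)
  fix x i
  assume x: "\<And>Y. (\<And>W. W \<in> {D. \<forall>i\<in>I. PuP (f i D) \<in> low R} \<Longrightarrow> derivable (ShN Y \<turnstile>\<^sub>- W)) \<Longrightarrow>
      derivable (ShN Y \<turnstile>\<^sub>- x)" and i: "i \<in> I"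
  show "PuP (f i x) \<in> low R"
  proof (rule low_closedI[OF assms(1)])
    fix Z
    assume Z: "\<And>W. W \<in> low R \<Longrightarrow> derivable (W \<turnstile>\<^sub>+ Z)"
    have "derivable (ShN (g i Z) \<turnstile>\<^sub>- x)"
      by (rule x) (auto simp flip: assms(2) intro: Z i)
    then show "derivable (PuP (f i x) \<turnstile>\<^sub>+ Z)"
      by (simp add: assms(2))
  qed
qed

lemma clSP_residual_upp:
  assumes "L \<in> gcarN canonical"
    and "\<And>i X Z. derivable (Z \<turnstile>\<^sub>- PuN (f i X)) \<longleftrightarrow> derivable (X \<turnstile>\<^sub>+ ShP (g i Z))"
  shows "clSP {X. \<forall>i\<in>I. PuN (f i X) \<in> upp L} \<subseteq> {X. \<forall>i\<in>I. PuN (f i X) \<in> upp L}"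
proof (rule clSP_closedI, intro CollectI ballI)
  fix x i
  assume x: "\<And>Y. (\<And>W. W \<in> {X. \<forall>i\<in>I. PuN (f i X) \<in> upp L} \<Longrightarrow> derivable (W \<turnstile>\<^sub>+ ShP Y)) \<Longrightarrow>
      derivable (x \<turnstile>\<^sub>+ ShP Y)" and i: "i \<in> I"
  show "PuN (f i x) \<in> upp L"
  proof (rule upp_closedI[OF assms(1)])
    fix Z
    assume Z: "\<And>W. W \<in> upp L \<Longrightarrow> derivable (Z \<turnstile>\<^sub>- W)"
    have "derivable (x \<turnstile>\<^sub>+ ShP (g i Z))"
      by (rule x) (auto simp flip: assms(2) intro: Z i)
    then show "derivable (Z \<turnstile>\<^sub>- PuN (f i x))"
      by (simp add: assms(2))
  qed
qed

lemma clSN_residual_upp: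
  assumes "L \<in> gcarN canonical"
    and "\<And>i D Z. derivable (Z \<turnstile>\<^sub>- PuN (f i D)) \<longleftrightarrow> derivable (ShN (g i Z) \<turnstile>\<^sub>- D)"
  shows "clSN {D. \<forall>i\<in>I. PuN (f i D) \<in> upp L} \<subseteq> {D. \<forall>i\<in>I. PuN (f i D) \<in> upp L}"
proof (rule clSN_closedI, intro CollectI ballI)
  fix x i
  assume x: "\<And>Y. (\<And>W. W \<in> {D. \<forall>i\<in>I. PuN (f i D) \<in> upp L} \<Longrightarrow> derivable (ShN Y \<turnstile>\<^sub>- W)) \<Longrightarrow>
      derivable (ShN Y \<turnstile>\<^sub>- x)" and i: "i \<in> I"
  show "PuN (f i x) \<in> upp L"
  proof (rule upp_closedI[OF assms(1)])
    fix Z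
    assume Z: "\<And>W. W \<in> upp L \<Longrightarrow> derivable (Z \<turnstile>\<^sub>- W)"
    have "derivable (ShN (g i Z) \<turnstile>\<^sub>- x)"
      by (rule x) (auto simp flip: assms(2) intro: Z i)
    then show "derivable (Z \<turnstile>\<^sub>- PuN (f i x))"
      by (simp add: assms(2))
  qed
qed

text \<open>One entry per variant, in the order of the fields \<open>tensl\<close> to
  \<open>slar\<close>. \<open>trans\<close> joins the two halves of a display triple when its outer
  sequents are to be related.\<close>

lemmas variants_closed =
  clSN_residual_upp[OF _ display(16)[symmetric]]
  clSN_residual_upp[OF _ display(7)[symmetric]]
  clSN_residual_low[OF _ trans[OF display(11,12)]]
  clSP_residual_low[OF _ display(11)]
  clSP_residual_upp[OF _ trans[OF display(15,16), symmetric]]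
  clSP_residual_low[OF _ display(6)]
  clSN_residual_upp[OF _ display(13)]
  clSN_residual_low[OF _ trans[OF display(9,10)]]
  clSN_residual_upp[OF _ display(8)]
  clSP_residual_low[OF _ display(9)]
  clSP_residual_low[OF _ display(5)[symmetric]]
  clSP_residual_upp[OF _ trans[OF display(13,14)]]

lemma canonical_operations:
  defines "GP \<equiv> gcarP canonical" and "GN \<equiv> gcarN canonical"
    and "leGP \<equiv> le_pos canonical" and "leGN \<equiv> le_neg canonical"
  shows "operation GP leGP GP leGP (carP canonical) (leP canonical) (tens canonical)"
    "operation GP leGP GN leGN\<inverse>\<inverse> (carP canonical) (leP canonical) (osl canonical)"
    "operation GN leGN\<inverse>\<inverse> GP leGP (carP canonical) (leP canonical) (omin canonical)"
    "operation GN leGN GN leGN (carN canonical) (leN canonical) (opl canonical)"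
    "operation GP leGP\<inverse>\<inverse> GN leGN (carN canonical) (leN canonical) (bsl canonical)"
    "operation GN leGN GP leGP\<inverse>\<inverse> (carN canonical) (leN canonical) (sla canonical)"
    "operation GN leGN GP leGP (carSN canonical) (leSN canonical) (tensl canonical)"
    "operation GN leGN GN leGN\<inverse>\<inverse> (carSN canonical) (leSN canonical) (osll canonical)"
    "operation GP leGP\<inverse>\<inverse> GP leGP (carSN canonical) (leSN canonical) (ominl canonical)"
    "operation GP leGP GN leGN (carSP canonical) (leSP canonical) (opll canonical)"
    "operation GN leGN\<inverse>\<inverse> GN leGN (carSP canonical) (leSP canonical) (bsll canonical)"
    "operation GP leGP GP leGP\<inverse>\<inverse> (carSP canonical) (leSP canonical) (slal canonical)"
    "operation GP leGP GN leGN (carSN canonical) (leSN canonical) (tensr canonical)"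
    "operation GP leGP GP leGP\<inverse>\<inverse> (carSN canonical) (leSN canonical) (oslr canonical)"
    "operation GN leGN\<inverse>\<inverse> GN leGN (carSN canonical) (leSN canonical) (ominr canonical)"
    "operation GN leGN GP leGP (carSP canonical) (leSP canonical) (oplr canonical)"
    "operation GP leGP\<inverse>\<inverse> GP leGP (carSP canonical) (leSP canonical) (bslr canonical)"
    "operation GN leGN GN leGN\<inverse>\<inverse> (carSP canonical) (leSP canonical) (slar canonical)"
  unfolding operation_def assms
  \<comment> \<open>Values are closed by idempotence or by \<open>variants_closed\<close>. Since
    \<open>upp\<close> and the negative orders reverse inclusion, the duals in the signature are
    exactly what makes each set expression monotone.\<close>
  by (auto simp: clP_idem clN_idem variants_closed intro!: clP_mono clN_mono
      dest!: le_pos_low le_neg_upp)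

text \<open>Brings quantifiers over generators into the form of quantifiers over their two
  arguments, where the display postulates apply.\<close>

lemma all_binary_image:
  "(\<forall>z. (\<exists>x y. z = f x y \<and> x \<in> A \<and> y \<in> B) \<longrightarrow> Q z) \<longleftrightarrow> (\<forall>x\<in>A. \<forall>y\<in>B. Q (f x y))"
  by blast

lemma image_binary_image_subset:
  "h ` {f x y |x y. x \<in> A \<and> y \<in> B} \<subseteq> C \<longleftrightarrow> (\<forall>x\<in>A. \<forall>y\<in>B. h (f x y) \<in> C)"
  by blast

lemmas canonical_order_simps =
  le_neut_clP le_neut_clN le_pos_clP le_neg_clN le_pos_shifted le_neg_shifted
  all_binary_image image_binary_image_subset

theorem canonical_fp_lg_algebra: "fp_lg_algebra canonical"
proof -
  have posets: "poset_on (carP canonical) (leP canonical)" "poset_on (carSP canonical) (leSP canonical)"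
    "poset_on (carN canonical) (leN canonical)" "poset_on (carSN canonical) (leSN canonical)"
    by (auto simp: poset_on_def reflp_on_def transp_on_def antisymp_on_def)
  have shifts: "adjunction (carP canonical) (leP canonical) (carSN canonical) (leSN canonical)
      (up canonical) (ddown canonical)"
    "adjunction (carSP canonical) (leSP canonical) (carN canonical) (leN canonical)
      (uup canonical) (down canonical)"
    \<comment> \<open>Either side of an adjunction says that all pairs of members form derivable
      neutral sequents.\<close>
    by (auto simp: adjunction_def monotone_on_def dest: canonical_shifts_closed[THEN subsetD])
  have weakening:
    "weakening_relation (carP canonical) (leP canonical) (carSP canonical) (leSP canonical) (relPos canonical)"
    "weakening_relation (carP canonical) (leP canonical) (carN canonical) (leN canonical) (relNeut canonical)"
    "weakening_relation (carSN canonical) (leSN canonical) (carN canonical) (leN canonical) (relNeg canonical)"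
    unfolding weakening_relation_def canonical_simps by blast+
  \<comment> \<open>On generators the neutral residuations become display postulates. For the
    positive and negative ones the sides coincide, because each variant is defined as the
    residual.\<close>
  show ?thesis
    unfolding fp_lg_algebra_def Let_def
    by (intro conjI posets shifts weakening canonical_operations)
      (auto simp: canonical_order_simps display(1-4))
qed

section \<open>The canonical interpretation\<close>

lemma lift2_eq_Some [simp]: "lift2 f x y = Some z \<longleftrightarrow> (\<exists>a b. x = Some a \<and> y = Some b \<and> z = f a b)"
  by (cases x; cases y) (auto simp: lift2_def)

lemma int_oper:
  "oper_pos X1 = Some P1 \<Longrightarrow> int_pos_st A v w X1 = int_pos_fm A v w P1"
  "oper_neg X2 = Some P2 \<Longrightarrow> int_neg_st A v w X2 = int_neg_fm A v w P2"
  "oper_spos X3 = Some P3 \<Longrightarrow> int_spos_st A v w X3 = int_spos_fm A v w P3"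
  "oper_sneg X4 = Some P4 \<Longrightarrow> int_sneg_st A v w X4 = int_sneg_fm A v w P4"
  "oper_gpos X5 = Some P5 \<Longrightarrow> int_gpos_st A v w X5 = int_gpos_fm A v w P5"
  "oper_gneg X6 = Some P6 \<Longrightarrow> int_gneg_st A v w X6 = int_gneg_fm A v w P6"
  by (induction X1 and X2 and X3 and X4 and X5 and X6 arbitrary: P1 and P2 and P3 and P4 and P5 and P6)
    auto

text \<open>At these signs every possible root connective is a PIA node, so the formula stays
  whole.\<close>

lemma std_fm_PIA [simp]:
  "std_pos_fm Minus P1 = FmP P1" "std_neg_fm Plus P2 = FmN P2"
  "std_spos_fm Plus P3 = FmSP P3" "std_sneg_fm Minus P4 = FmSN P4"
proof -
  show "std_pos_fm Minus P1 = FmP P1" by (cases P1) simp_all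
  show "std_neg_fm Plus P2 = FmN P2" by (cases P2) simp_all
  show "std_spos_fm Plus P3 = FmSP P3" by (cases P3) simp
  show "std_sneg_fm Minus P4 = FmSN P4" by (cases P4) simp
qed

text \<open>Each argument is displayed by a pure residual, replaced, and moved back, so no sequent
  on the way leaves the neutral turnstile. The same works for the five connectives that
  follow.\<close>

lemma neut_tens_cong:
  assumes "\<And>D. derivable (X' \<turnstile>\<^sub>0 D) \<Longrightarrow> derivable (X \<turnstile>\<^sub>0 D)"
    and "\<And>D. derivable (Y' \<turnstile>\<^sub>0 D) \<Longrightarrow> derivable (Y \<turnstile>\<^sub>0 D)"
    and "derivable (PuP (X' \<otimes>\<^sub>s Y') \<turnstile>\<^sub>0 D)"
  shows "derivable (PuP (X \<otimes>\<^sub>s Y) \<turnstile>\<^sub>0 D)"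
  using assms display(1,2) by metis

lemma neut_osl_cong:
  assumes "\<And>D. derivable (X' \<turnstile>\<^sub>0 D) \<Longrightarrow> derivable (X \<turnstile>\<^sub>0 D)"
    and "\<And>Z. derivable (Z \<turnstile>\<^sub>0 G') \<Longrightarrow> derivable (Z \<turnstile>\<^sub>0 G)"
    and "derivable (PuP (X' \<oslash>\<^sub>s G') \<turnstile>\<^sub>0 D)"
  shows "derivable (PuP (X \<oslash>\<^sub>s G) \<turnstile>\<^sub>0 D)"
  using assms display(3,4) by metis

lemma neut_omin_cong:
  assumes "\<And>Z. derivable (Z \<turnstile>\<^sub>0 G') \<Longrightarrow> derivable (Z \<turnstile>\<^sub>0 G)"
    and "\<And>D. derivable (X' \<turnstile>\<^sub>0 D) \<Longrightarrow> derivable (X \<turnstile>\<^sub>0 D)"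
    and "derivable (PuP (G' \<ominus>\<^sub>s X') \<turnstile>\<^sub>0 D)"
  shows "derivable (PuP (G \<ominus>\<^sub>s X) \<turnstile>\<^sub>0 D)"
  using assms display(3,4) by metis

lemma neut_opl_cong:
  assumes "\<And>Z. derivable (Z \<turnstile>\<^sub>0 G') \<Longrightarrow> derivable (Z \<turnstile>\<^sub>0 G)"
    and "\<And>Z. derivable (Z \<turnstile>\<^sub>0 D') \<Longrightarrow> derivable (Z \<turnstile>\<^sub>0 D)"
    and "derivable (X \<turnstile>\<^sub>0 PuN (G' \<oplus>\<^sub>s D'))"
  shows "derivable (X \<turnstile>\<^sub>0 PuN (G \<oplus>\<^sub>s D))"
  using assms display(3,4) by metis

lemma neut_bsl_cong:
  assumes "\<And>D. derivable (X' \<turnstile>\<^sub>0 D) \<Longrightarrow> derivable (X \<turnstile>\<^sub>0 D)"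
    and "\<And>Z. derivable (Z \<turnstile>\<^sub>0 G') \<Longrightarrow> derivable (Z \<turnstile>\<^sub>0 G)"
    and "derivable (Z \<turnstile>\<^sub>0 PuN (X' \<setminus>\<^sub>s G'))"
  shows "derivable (Z \<turnstile>\<^sub>0 PuN (X \<setminus>\<^sub>s G))"
  using assms display(1,2) by metis

lemma neut_sla_cong:
  assumes "\<And>Z. derivable (Z \<turnstile>\<^sub>0 G') \<Longrightarrow> derivable (Z \<turnstile>\<^sub>0 G)"
    and "\<And>D. derivable (X' \<turnstile>\<^sub>0 D) \<Longrightarrow> derivable (X \<turnstile>\<^sub>0 D)"
    and "derivable (Z \<turnstile>\<^sub>0 PuN (G' /\<^sub>s X'))"
  shows "derivable (Z \<turnstile>\<^sub>0 PuN (G /\<^sub>s X))"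
  using assms display(1,2) by metis

text \<open>Below a neutral turnstile every skeleton position can be displayed by the pure connectives alone,
  so the sequent stays neutral, which is what the translation rules require.\<close>

lemma fold_std_fm:
  "derivable (PuP (std_pos_fm Plus P1) \<turnstile>\<^sub>0 D1) \<Longrightarrow> derivable (PuP (FmP P1) \<turnstile>\<^sub>0 D1)"
  "derivable (X2 \<turnstile>\<^sub>0 PuN (std_neg_fm Minus P2)) \<Longrightarrow> derivable (X2 \<turnstile>\<^sub>0 PuN (FmN P2))"
  "derivable (ShP (std_spos_fm Plus P3) \<turnstile>\<^sub>0 D3) \<Longrightarrow> derivable (ShP (FmSP P3) \<turnstile>\<^sub>0 D3)"
  "derivable (X4 \<turnstile>\<^sub>0 ShN (std_sneg_fm Minus P4)) \<Longrightarrow> derivable (X4 \<turnstile>\<^sub>0 ShN (FmSN P4))"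
  "derivable (std_gpos_fm Plus P5 \<turnstile>\<^sub>0 D5) \<Longrightarrow> derivable (\<langle>P5\<rangle>\<^sub>+ \<turnstile>\<^sub>0 D5)"
  "derivable (X6 \<turnstile>\<^sub>0 std_gneg_fm Minus P6) \<Longrightarrow> derivable (X6 \<turnstile>\<^sub>0 \<langle>P6\<rangle>\<^sub>-)"
proof (induction P1 and P2 and P3 and P4 and P5 and P6
    arbitrary: D1 and X2 and D3 and X4 and D5 and X6)
  case (TensF a b)
  then show ?case using neut_tens_cong[OF TensF.IH] tr_tens by simp
next
  case (OslF a b)
  then show ?case using neut_osl_cong[OF OslF.IH] tr_osl by simp
next
  case (OminF a b)
  then show ?case using neut_omin_cong[OF OminF.IH] tr_omin by simp
next
  case (OplF a b)
  then show ?case using neut_opl_cong[OF OplF.IH] tr_opl by simp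
next
  case (BslF a b)
  then show ?case using neut_bsl_cong[OF BslF.IH] tr_bsl by simp
next
  case (SlaF a b)
  then show ?case using neut_sla_cong[OF SlaF.IH] tr_sla by simp
qed simp_all

section \<open>The canonical valuation and the truth lemma\<close>

definition canP :: "nat \<Rightarrow> pos_st set" where
  "canP i = {X. derivable (PuP X \<turnstile>\<^sub>+ PuP (FmP (PAtom i)))}"

definition canN :: "nat \<Rightarrow> neg_st set" where
  "canN i = {D. derivable (PuN (FmN (NAtom i)) \<turnstile>\<^sub>- PuN D)}"

text \<open>A set cut out by a single test is closed.\<close>

lemma canP_carP: "canP i \<in> carP canonical"
  by (auto simp: canP_def clP_def)

lemma canN_carN: "canN i \<in> carN canonical"
  by (auto simp: canN_def clN_def)

lemma derivable_clP: "X \<in> clP S \<Longrightarrow> (\<And>Z. Z \<in> S \<Longrightarrow> derivable (PuP Z \<turnstile>\<^sub>+ Y)) \<Longrightarrow> derivable (PuP X \<turnstile>\<^sub>+ Y)"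
  by (auto simp: clP_def)

lemma derivable_clN: "D \<in> clN S \<Longrightarrow> (\<And>Z. Z \<in> S \<Longrightarrow> derivable (G \<turnstile>\<^sub>- PuN Z)) \<Longrightarrow> derivable (G \<turnstile>\<^sub>- PuN D)"
  by (auto simp: clN_def)

lemmas clP_inc = clP_extensive[THEN subsetD]
lemmas clN_inc = clN_extensive[THEN subsetD]

text \<open>A shifted formula needs two target forms: the formula itself, for the premises of
  tonicity rules, and its standardisation, for \<open>truth_st\<close>. For a pure formula they
  agree by \<open>std_fm_PIA\<close>. Tonicity rules treat the generators of a compound value, and
  \<open>derivable_clP\<close> or \<open>derivable_clN\<close> extends the result to the
  closure.\<close>

lemma truth_fm:
  "std_pos_fm Plus P1 \<in> int_pos_fm canonical canP canN P1 \<and>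
    (\<forall>X\<in>int_pos_fm canonical canP canN P1. derivable (PuP X \<turnstile>\<^sub>+ PuP (FmP P1)))"
  "std_neg_fm Minus P2 \<in> int_neg_fm canonical canP canN P2 \<and>
    (\<forall>D\<in>int_neg_fm canonical canP canN P2. derivable (PuN (FmN P2) \<turnstile>\<^sub>- PuN D))"
  "ShP (FmSP P3) \<in> int_spos_fm canonical canP canN P3 \<and>
    (\<forall>X\<in>int_spos_fm canonical canP canN P3. derivable (X \<turnstile>\<^sub>+ ShP (FmSP P3)) \<and>
      derivable (X \<turnstile>\<^sub>+ ShP (std_spos_fm Minus P3)))"
  "ShN (FmSN P4) \<in> int_sneg_fm canonical canP canN P4 \<and>
    (\<forall>D\<in>int_sneg_fm canonical canP canN P4. derivable (ShN (FmSN P4) \<turnstile>\<^sub>- D) \<and>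
      derivable (ShN (std_sneg_fm Plus P4) \<turnstile>\<^sub>- D))"
  "std_gpos_fm Plus P5 \<in> low (int_gpos_fm canonical canP canN P5) \<and>
    (\<forall>X\<in>low (int_gpos_fm canonical canP canN P5). derivable (X \<turnstile>\<^sub>+ \<langle>P5\<rangle>\<^sub>+))"
  "std_gneg_fm Minus P6 \<in> upp (int_gneg_fm canonical canP canN P6) \<and>
    (\<forall>D\<in>upp (int_gneg_fm canonical canP canN P6). derivable (\<langle>P6\<rangle>\<^sub>- \<turnstile>\<^sub>- D))"
proof (induction P1 and P2 and P3 and P4 and P5 and P6)
  case (PAtom i)
  show ?case using ax_pos[of i] by (simp add: canP_def)
next
  case (NAtom i)
  show ?case using ax_neg[of i] by (simp add: canN_def)
next
  case (TensF a b)
  then show ?case by (auto intro!: clP_inc intro: ton_tens[simplified] elim!: derivable_clP)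
next
  case (OslF a b)
  then show ?case by (auto intro!: clP_inc intro: ton_osl[simplified] elim!: derivable_clP)
next
  case (OminF a b)
  then show ?case by (auto intro!: clP_inc intro: ton_omin[simplified] elim!: derivable_clP)
next
  case (OplF a b)
  then show ?case by (auto intro!: clN_inc intro: ton_opl[simplified] elim!: derivable_clN)
next
  case (BslF a b)
  then show ?case by (auto intro!: clN_inc intro: ton_bsl[simplified] elim!: derivable_clN)
next
  case (SlaF a b)
  then show ?case by (auto intro!: clN_inc intro: ton_sla[simplified] elim!: derivable_clN)
next
  case (DownF a)
  \<comment> \<open>Members of the value of \<open>\<down>\<^sub>o a\<close> are neutrally below all
    members of the value of \<open>a\<close>, among which is the standardised
    \<open>a\<close>.\<close>
  then have std: "derivable (X \<turnstile>\<^sub>0 PuN (std_neg_fm Minus a))"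
    if "X \<in> int_spos_fm canonical canP canN (\<down>\<^sub>o a)" for X
    using that by simp
  \<comment> \<open>The formula must be folded while the sequent is still neutral; display then
    yields the premise of \<open>tr_down\<close>.\<close>
  have "derivable (X \<turnstile>\<^sub>+ ShP (FmSP (\<down>\<^sub>o a)))"
    if "X \<in> int_spos_fm canonical canP canN (\<down>\<^sub>o a)" for X
    using fold_std_fm(2)[OF std[OF that]] tr_down[of X a] by (simp add: display(20))
  moreover have "ShP (FmSP (\<down>\<^sub>o a)) \<in> int_spos_fm canonical canP canN (\<down>\<^sub>o a)"
    using DownF ton_down[of a] by (simp add: display(20))
  ultimately show ?case
    using std by (simp add: display(20) del: int_spos_fm.simps)
next
  case (UpF a)
  then have std: "derivable (PuP (std_pos_fm Plus a) \<turnstile>\<^sub>0 D)"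
    if "D \<in> int_sneg_fm canonical canP canN (\<up>\<^sub>o a)" for D
    using that by simp
  have "derivable (ShN (FmSN (\<up>\<^sub>o a)) \<turnstile>\<^sub>- D)"
    if "D \<in> int_sneg_fm canonical canP canN (\<up>\<^sub>o a)" for D
    using fold_std_fm(1)[OF std[OF that]] tr_up[of a D] by (simp add: display(21))
  moreover have "ShN (FmSN (\<up>\<^sub>o a)) \<in> int_sneg_fm canonical canP canN (\<up>\<^sub>o a)"
    using UpF ton_up[of _ a] by (simp add: display(21))
  ultimately show ?case
    using std by (simp add: display(21) del: int_sneg_fm.simps)
qed auto

text \<open>Serves the PIA roots: a subtree made operational keeps its value, so
  \<open>truth_fm\<close> applies to the resulting formula.\<close>

lemma truth_oper:
  "oper_pos X1 = Some P1 \<Longrightarrow> Z1 \<in> int_pos_st canonical canP canN X1 \<Longrightarrow>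
    derivable (PuP Z1 \<turnstile>\<^sub>+ PuP (FmP P1))"
  "oper_neg X2 = Some P2 \<Longrightarrow> Z2 \<in> int_neg_st canonical canP canN X2 \<Longrightarrow>
    derivable (PuN (FmN P2) \<turnstile>\<^sub>- PuN Z2)"
  "oper_spos X3 = Some P3 \<Longrightarrow> ShP (FmSP P3) \<in> int_spos_st canonical canP canN X3"
  "oper_sneg X4 = Some P4 \<Longrightarrow> ShN (FmSN P4) \<in> int_sneg_st canonical canP canN X4"
  using truth_fm by (simp_all add: int_oper)

text \<open>The conjuncts treat the two root signs. At a skeleton sign a pure binary connective
  yields a generator of the value, while a shift or variant is handled by display. At a PIA sign
  \<open>truth_oper\<close> applies, and connectives without operational form contribute nothing, as
  standardisation is undefined there.\<close>

lemma truth_st: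
  "(\<forall>Y. std_pos Plus X1 = Some Y \<longrightarrow> Y \<in> int_pos_st canonical canP canN X1) \<and>
   (\<forall>Y. std_pos Minus X1 = Some Y \<longrightarrow>
      (\<forall>Z\<in>int_pos_st canonical canP canN X1. derivable (PuP Z \<turnstile>\<^sub>+ PuP Y)))"
  "(\<forall>Y. std_neg Minus X2 = Some Y \<longrightarrow> Y \<in> int_neg_st canonical canP canN X2) \<and>
   (\<forall>Y. std_neg Plus X2 = Some Y \<longrightarrow>
      (\<forall>Z\<in>int_neg_st canonical canP canN X2. derivable (PuN Y \<turnstile>\<^sub>- PuN Z)))"
  "(\<forall>Y. std_spos Plus X3 = Some Y \<longrightarrow> ShP Y \<in> int_spos_st canonical canP canN X3) \<and>
   (\<forall>Y. std_spos Minus X3 = Some Y \<longrightarrow>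
      (\<forall>Z\<in>int_spos_st canonical canP canN X3. derivable (Z \<turnstile>\<^sub>+ ShP Y)))"
  "(\<forall>Y. std_sneg Minus X4 = Some Y \<longrightarrow> ShN Y \<in> int_sneg_st canonical canP canN X4) \<and>
   (\<forall>Y. std_sneg Plus X4 = Some Y \<longrightarrow>
      (\<forall>Z\<in>int_sneg_st canonical canP canN X4. derivable (ShN Y \<turnstile>\<^sub>- Z)))"
  "(\<forall>Y. std_gpos Plus X5 = Some Y \<longrightarrow> Y \<in> low (int_gpos_st canonical canP canN X5)) \<and>
   (\<forall>Y. std_gpos Minus X5 = Some Y \<longrightarrow>
      (\<forall>Z\<in>low (int_gpos_st canonical canP canN X5). derivable (Z \<turnstile>\<^sub>+ Y)))"
  "(\<forall>Y. std_gneg Minus X6 = Some Y \<longrightarrow> Y \<in> upp (int_gneg_st canonical canP canN X6)) \<and>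
   (\<forall>Y. std_gneg Plus X6 = Some Y \<longrightarrow>
      (\<forall>Z\<in>upp (int_gneg_st canonical canP canN X6). derivable (Y \<turnstile>\<^sub>- Z)))"
proof (induction X1 and X2 and X3 and X4 and X5 and X6)
  case (FmP a)
  then show ?case using truth_fm(1)[of a] by simp
next
  case (FmN a)
  then show ?case using truth_fm(2)[of a] by simp
next
  case (FmSP a)
  then show ?case using truth_fm(3)[of a] by simp
next
  case (FmSN a)
  then show ?case using truth_fm(4)[of a] by simp
next
  case (DDown a)
  then show ?case by (auto simp flip: derivable_ddown)
next
  case (UUp a)
  then show ?case by (auto simp flip: derivable_uup)
next
  case (Tens a b)
  then show ?case
    using truth_oper(1)[of "a \<otimes>\<^sub>s b"]
    by (intro conjI; force intro: clP_inc simp del: oper_pos.simps)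
next
  case (Osl a b)
  then show ?case
    using truth_oper(1)[of "a \<oslash>\<^sub>s b"]
    by (intro conjI; force intro: clP_inc simp del: oper_pos.simps)
next
  case (Omin a b)
  then show ?case
    using truth_oper(1)[of "a \<ominus>\<^sub>s b"]
    by (intro conjI; force intro: clP_inc simp del: oper_pos.simps)
next
  case (Opl a b)
  then show ?case
    using truth_oper(2)[of "a \<oplus>\<^sub>s b"]
    by (intro conjI; force intro: clN_inc simp del: oper_neg.simps)
next
  case (Bsl a b)
  then show ?case
    using truth_oper(2)[of "a \<setminus>\<^sub>s b"]
    by (intro conjI; force intro: clN_inc simp del: oper_neg.simps)
next
  case (Sla a b)
  then show ?case
    using truth_oper(2)[of "a /\<^sub>s b"]
    by (intro conjI; force intro: clN_inc simp del: oper_neg.simps)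
next
  case (Down a)
  then show ?case
    using truth_oper(3)[of "\<down>\<^sub>s a"]
    by (intro conjI; force simp: display(20)[symmetric] simp del: oper_spos.simps)
next
  case (Up a)
  then show ?case
    using truth_oper(4)[of "\<up>\<^sub>s a"]
    by (intro conjI; force simp: display(21)[symmetric] simp del: oper_sneg.simps)
next
  case (OplL a b)
  \<comment> \<open>Combining a member with the standardised \<open>b\<close> lands in the value of
    \<open>a\<close>, whose members derive the standardised \<open>a\<close>; display isolates the
    member again. The other variants follow this pattern.\<close>
  then show ?case by (auto simp: display(11)[symmetric])
next
  case (OplR a b)
  then show ?case by (auto simp: display(9)[symmetric])
next
  case (BslL a b)
  then show ?case by (auto simp: display(15,16))
next
  case (BslR a b)
  then show ?case by (auto simp: display(5))
next
  case (SlaL a b)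
  then show ?case by (auto simp: display(6)[symmetric])
next
  case (SlaR a b)
  then show ?case by (auto simp: display(13,14)[symmetric])
next
  case (TensL a b)
  then show ?case by (auto simp: display(16))
next
  case (TensR a b)
  then show ?case by (auto simp: display(13)[symmetric])
next
  case (OslL a b)
  then show ?case by (auto simp: display(7))
next
  case (OslR a b)
  then show ?case by (auto simp: display(9,10)[symmetric])
next
  case (OminL a b)
  then show ?case by (auto simp: display(11,12)[symmetric])
next
  case (OminR a b)
  then show ?case by (auto simp: display(8)[symmetric])
qed auto

section \<open>Countable subalgebras\<close>

instance pos_fm :: countable by countable_datatype
instance neg_fm :: countable by countable_datatype
instance spos_fm :: countable by countable_datatype
instance sneg_fm :: countable by countable_datatype
instance pos_st :: countable by countable_datatype
instance neg_st :: countable by countable_datatype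
instance spos_st :: countable by countable_datatype
instance sneg_st :: countable by countable_datatype

lemma
  assumes "fp_lg_algebra A"
  shows fp_poset: "poset_on (carP A) (leP A)"
    "poset_on (carSP A) (leSP A)"
    "poset_on (carN A) (leN A)"
    "poset_on (carSN A) (leSN A)"
    and fp_adjunction: "adjunction (carP A) (leP A) (carSN A) (leSN A) (up A) (ddown A)"
    "adjunction (carSP A) (leSP A) (carN A) (leN A) (uup A) (down A)"
    and fp_weakening: "weakening_relation (carP A) (leP A) (carSP A) (leSP A) (relPos A)"
    "weakening_relation (carP A) (leP A) (carN A) (leN A) (relNeut A)"
    "weakening_relation (carSN A) (leSN A) (carN A) (leN A) (relNeg A)"
    and fp_polarity: "\<forall>a\<in>carP A. \<forall>b\<in>carN A.
        (relNeg A (up A a) b \<longleftrightarrow> relNeut A a b) \<and> (relNeut A a b \<longleftrightarrow> relPos A a (down A b))"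
    and fp_operation: "operation (gcarP A) (le_pos A) (gcarP A) (le_pos A)
      (carP A) (leP A) (tens A)"
    "operation (gcarP A) (le_pos A) (gcarN A) (le_neg A)\<inverse>\<inverse>
      (carP A) (leP A) (osl A)"
    "operation (gcarN A) (le_neg A)\<inverse>\<inverse> (gcarP A) (le_pos A)
      (carP A) (leP A) (omin A)"
    "operation (gcarN A) (le_neg A) (gcarN A) (le_neg A)
      (carN A) (leN A) (opl A)"
    "operation (gcarP A) (le_pos A)\<inverse>\<inverse> (gcarN A) (le_neg A)
      (carN A) (leN A) (bsl A)"
    "operation (gcarN A) (le_neg A) (gcarP A) (le_pos A)\<inverse>\<inverse>
      (carN A) (leN A) (sla A)"
    "operation (gcarN A) (le_neg A) (gcarP A) (le_pos A)
      (carSN A) (leSN A) (tensl A)"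
    "operation (gcarN A) (le_neg A) (gcarN A) (le_neg A)\<inverse>\<inverse>
      (carSN A) (leSN A) (osll A)"
    "operation (gcarP A) (le_pos A)\<inverse>\<inverse> (gcarP A) (le_pos A)
      (carSN A) (leSN A) (ominl A)"
    "operation (gcarP A) (le_pos A) (gcarN A) (le_neg A)
      (carSP A) (leSP A) (opll A)"
    "operation (gcarN A) (le_neg A)\<inverse>\<inverse> (gcarN A) (le_neg A)
      (carSP A) (leSP A) (bsll A)"
    "operation (gcarP A) (le_pos A) (gcarP A) (le_pos A)\<inverse>\<inverse>
      (carSP A) (leSP A) (slal A)"
    "operation (gcarP A) (le_pos A) (gcarN A) (le_neg A)
      (carSN A) (leSN A) (tensr A)"
    "operation (gcarP A) (le_pos A) (gcarP A) (le_pos A)\<inverse>\<inverse>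
      (carSN A) (leSN A) (oslr A)"
    "operation (gcarN A) (le_neg A)\<inverse>\<inverse> (gcarN A) (le_neg A)
      (carSN A) (leSN A) (ominr A)"
    "operation (gcarN A) (le_neg A) (gcarP A) (le_pos A)
      (carSP A) (leSP A) (oplr A)"
    "operation (gcarP A) (le_pos A)\<inverse>\<inverse> (gcarP A) (le_pos A)
      (carSP A) (leSP A) (bslr A)"
    "operation (gcarN A) (le_neg A) (gcarN A) (le_neg A)\<inverse>\<inverse>
      (carSP A) (leSP A) (slar A)"
    and fp_residuation: "\<forall>P\<in>gcarP A. \<forall>Q\<in>gcarP A. \<forall>N\<in>gcarN A.
           (le_neut A Q (Inl (bsl A P N)) \<longleftrightarrow> le_neut A (Inl (tens A P Q)) N) \<and>
           (le_neut A (Inl (tens A P Q)) N \<longleftrightarrow> le_neut A P (Inl (sla A N Q)))"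
    "\<forall>P\<in>gcarP A. \<forall>M\<in>gcarN A. \<forall>N\<in>gcarN A.
           (le_neut A (Inl (osl A P N)) M \<longleftrightarrow> le_neut A P (Inl (opl A M N))) \<and>
           (le_neut A P (Inl (opl A M N)) \<longleftrightarrow> le_neut A (Inl (omin A M P)) N)"
    "\<forall>P\<in>gcarP A. \<forall>Q\<in>gcarP A. \<forall>R\<in>gcarP A.
           (le_pos A Q (Inr (bslr A P R)) \<longleftrightarrow> le_pos A (Inl (tens A P Q)) R) \<and>
           (le_pos A (Inl (tens A P Q)) R \<longleftrightarrow> le_pos A P (Inr (slal A R Q)))"
    "\<forall>L\<in>gcarN A. \<forall>M\<in>gcarN A. \<forall>N\<in>gcarN A.
           (le_neg A (Inr (osll A L N)) M \<longleftrightarrow> le_neg A L (Inl (opl A M N))) \<and>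
           (le_neg A L (Inl (opl A M N)) \<longleftrightarrow> le_neg A (Inr (ominr A M L)) N)"
    "\<forall>Q\<in>gcarP A. \<forall>L\<in>gcarN A. \<forall>N\<in>gcarN A.
           (le_pos A Q (Inr (bsll A L N)) \<longleftrightarrow> le_neg A (Inr (tensl A L Q)) N) \<and>
           (le_neg A (Inr (tensl A L Q)) N \<longleftrightarrow> le_neg A L (Inl (sla A N Q)))"
    "\<forall>P\<in>gcarP A. \<forall>R\<in>gcarP A. \<forall>M\<in>gcarN A.
           (le_neg A (Inr (oslr A P R)) M \<longleftrightarrow> le_pos A P (Inr (oplr A M R))) \<and>
           (le_pos A P (Inr (oplr A M R)) \<longleftrightarrow> le_pos A (Inl (omin A M P)) R)"
    "\<forall>P\<in>gcarP A. \<forall>L\<in>gcarN A. \<forall>N\<in>gcarN A.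
           (le_neg A L (Inl (bsl A P N)) \<longleftrightarrow> le_neg A (Inr (tensr A P L)) N) \<and>
           (le_neg A (Inr (tensr A P L)) N \<longleftrightarrow> le_pos A P (Inr (slar A N L)))"
    "\<forall>P\<in>gcarP A. \<forall>R\<in>gcarP A. \<forall>N\<in>gcarN A.
           (le_pos A (Inl (osl A P N)) R \<longleftrightarrow> le_pos A P (Inr (opll A R N))) \<and>
           (le_pos A P (Inr (opll A R N)) \<longleftrightarrow> le_neg A (Inr (ominl A R P)) N)"
  using assms unfolding fp_lg_algebra_def Let_def by - (elim conjE, assumption)+

lemma fp_lg_algebra_closed:
  assumes "fp_lg_algebra A"
  shows "p0 \<in> carP A \<Longrightarrow> up A p0 \<in> carSN A"
    "p1 \<in> carSN A \<Longrightarrow> ddown A p1 \<in> carP A"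
    "p2 \<in> carSP A \<Longrightarrow> uup A p2 \<in> carN A"
    "p3 \<in> carN A \<Longrightarrow> down A p3 \<in> carSP A"
    "x0 \<in> gcarP A \<Longrightarrow> y0 \<in> gcarP A \<Longrightarrow> tens A x0 y0 \<in> carP A"
    "x1 \<in> gcarP A \<Longrightarrow> y1 \<in> gcarN A \<Longrightarrow> osl A x1 y1 \<in> carP A"
    "x2 \<in> gcarN A \<Longrightarrow> y2 \<in> gcarP A \<Longrightarrow> omin A x2 y2 \<in> carP A"
    "x3 \<in> gcarN A \<Longrightarrow> y3 \<in> gcarN A \<Longrightarrow> opl A x3 y3 \<in> carN A"
    "x4 \<in> gcarP A \<Longrightarrow> y4 \<in> gcarN A \<Longrightarrow> bsl A x4 y4 \<in> carN A"
    "x5 \<in> gcarN A \<Longrightarrow> y5 \<in> gcarP A \<Longrightarrow> sla A x5 y5 \<in> carN A"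
    "x6 \<in> gcarN A \<Longrightarrow> y6 \<in> gcarP A \<Longrightarrow> tensl A x6 y6 \<in> carSN A"
    "x7 \<in> gcarN A \<Longrightarrow> y7 \<in> gcarN A \<Longrightarrow> osll A x7 y7 \<in> carSN A"
    "x8 \<in> gcarP A \<Longrightarrow> y8 \<in> gcarP A \<Longrightarrow> ominl A x8 y8 \<in> carSN A"
    "x9 \<in> gcarP A \<Longrightarrow> y9 \<in> gcarN A \<Longrightarrow> opll A x9 y9 \<in> carSP A"
    "x10 \<in> gcarN A \<Longrightarrow> y10 \<in> gcarN A \<Longrightarrow> bsll A x10 y10 \<in> carSP A"
    "x11 \<in> gcarP A \<Longrightarrow> y11 \<in> gcarP A \<Longrightarrow> slal A x11 y11 \<in> carSP A"
    "x12 \<in> gcarP A \<Longrightarrow> y12 \<in> gcarN A \<Longrightarrow> tensr A x12 y12 \<in> carSN A"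
    "x13 \<in> gcarP A \<Longrightarrow> y13 \<in> gcarP A \<Longrightarrow> oslr A x13 y13 \<in> carSN A"
    "x14 \<in> gcarN A \<Longrightarrow> y14 \<in> gcarN A \<Longrightarrow> ominr A x14 y14 \<in> carSN A"
    "x15 \<in> gcarN A \<Longrightarrow> y15 \<in> gcarP A \<Longrightarrow> oplr A x15 y15 \<in> carSP A"
    "x16 \<in> gcarP A \<Longrightarrow> y16 \<in> gcarP A \<Longrightarrow> bslr A x16 y16 \<in> carSP A"
    "x17 \<in> gcarN A \<Longrightarrow> y17 \<in> gcarN A \<Longrightarrow> slar A x17 y17 \<in> carSP A"
  using fp_adjunction[OF assms] fp_operation[OF assms]
  by (simp_all add: operation_def adjunction_def image_subset_iff)

lemma gcar_iff [simp]:
  "Inl x \<in> gcarP A \<longleftrightarrow> x \<in> carP A" "Inr x' \<in> gcarP A \<longleftrightarrow> x' \<in> carSP A"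
  "Inl y \<in> gcarN A \<longleftrightarrow> y \<in> carN A" "Inr y' \<in> gcarN A \<longleftrightarrow> y' \<in> carSN A"
  by (auto simp: gcarP_def gcarN_def)

lemma int_fm_in_carrier:
  assumes "fp_lg_algebra A" "\<And>i. v i \<in> carP A" "\<And>i. w i \<in> carN A"
  shows "int_pos_fm A v w P1 \<in> carP A" "int_neg_fm A v w P2 \<in> carN A"
    "int_spos_fm A v w P3 \<in> carSP A" "int_sneg_fm A v w P4 \<in> carSN A"
    "int_gpos_fm A v w P5 \<in> gcarP A" "int_gneg_fm A v w P6 \<in> gcarN A"
  by (induction P1 and P2 and P3 and P4 and P5 and P6)
    (simp_all add: assms fp_lg_algebra_closed)

lemma int_st_in_carrier:
  assumes "fp_lg_algebra A" "\<And>i. v i \<in> carP A" "\<And>i. w i \<in> carN A"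
  shows "int_pos_st A v w X1 \<in> carP A" "int_neg_st A v w X2 \<in> carN A"
    "int_spos_st A v w X3 \<in> carSP A" "int_sneg_st A v w X4 \<in> carSN A"
    "int_gpos_st A v w X5 \<in> gcarP A" "int_gneg_st A v w X6 \<in> gcarN A"
  by (induction X1 and X2 and X3 and X4 and X5 and X6)
    (simp_all add: assms int_fm_in_carrier fp_lg_algebra_closed)

text \<open>\<open>g\<close> and \<open>h\<close> decode the arguments, \<open>k\<close> the result.
  Monotonicity passes to the copy because decoding preserves the order on the way in and
  \<open>k\<close> reflects it on the way out.\<close>

lemma operation_pullback:
  assumes "operation CA lA CB lB CC lC f"
    and "\<And>x. x \<in> A \<Longrightarrow> g x \<in> CA" and "\<And>y. y \<in> B \<Longrightarrow> h y \<in> CB"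
    and "\<And>x y. x \<in> A \<Longrightarrow> y \<in> B \<Longrightarrow> f' x y \<in> C \<and> k (f' x y) = f (g x) (h y)"
    and "\<And>x y. lA' x y \<Longrightarrow> lA (g x) (g y)" and "\<And>x y. lB' x y \<Longrightarrow> lB (h x) (h y)"
    and "\<And>x y. lC (k x) (k y) \<Longrightarrow> lC' x y"
  shows "operation A lA' B lB' C lC' f'"
  using assms unfolding operation_def by (metis (no_types, lifting))

lemma poset_on_pullback:
  assumes "poset_on A le" and "d ` K \<subseteq> A" and "inj_on d K"
  shows "poset_on K (\<lambda>x y. le (d x) (d y))"
  using assms unfolding poset_on_def reflp_on_def transp_on_def antisymp_on_def inj_on_def
  by (meson image_subset_iff)

text \<open>The values of structures form the subalgebra of \<open>B\<close> generated by the values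
  of the atoms. The sets \<open>KP\<close> to \<open>KSN\<close> hold names for them in the target
  types, and \<open>dP\<close> to \<open>dSN\<close> decode the names.\<close>

locale relabelling =
  fixes B :: "('a, 'b, 'c, 'd) lg_structure" and v :: "nat \<Rightarrow> 'a" and w :: "nat \<Rightarrow> 'c"
    and KP :: "'p set" and KSP :: "'sp set" and KN :: "'n set" and KSN :: "'sn set"
    and dP :: "'p \<Rightarrow> 'a" and dSP :: "'sp \<Rightarrow> 'b" and dN :: "'n \<Rightarrow> 'c" and dSN :: "'sn \<Rightarrow> 'd"
  assumes alg: "fp_lg_algebra B" and v: "\<And>i. v i \<in> carP B" and w: "\<And>i. w i \<in> carN B"
    and bijP: "bij_betw dP KP (range (int_pos_st B v w))"
    and bijSP: "bij_betw dSP KSP (range (int_spos_st B v w))"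
    and bijN: "bij_betw dN KN (range (int_neg_st B v w))"
    and bijSN: "bij_betw dSN KSN (range (int_sneg_st B v w))"
begin

abbreviation "eP \<equiv> inv_into KP dP"
abbreviation "eSP \<equiv> inv_into KSP dSP"
abbreviation "eN \<equiv> inv_into KN dN"
abbreviation "eSN \<equiv> inv_into KSN dSN"
abbreviation "gP \<equiv> map_sum dP dSP"
abbreviation "gN \<equiv> map_sum dN dSN"

definition relab :: "('p, 'sp, 'n, 'sn) lg_structure" where
  "relab = \<lparr>carP = KP, carSP = KSP, carN = KN, carSN = KSN,
    leP = \<lambda>x y. leP B (dP x) (dP y), leSP = \<lambda>x y. leSP B (dSP x) (dSP y),
    leN = \<lambda>x y. leN B (dN x) (dN y), leSN = \<lambda>x y. leSN B (dSN x) (dSN y),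
    up = \<lambda>x. eSN (up B (dP x)), ddown = \<lambda>x. eP (ddown B (dSN x)),
    uup = \<lambda>x. eN (uup B (dSP x)), down = \<lambda>x. eSP (down B (dN x)),
    relPos = \<lambda>x y. relPos B (dP x) (dSP y), relNeut = \<lambda>x y. relNeut B (dP x) (dN y),
    relNeg = \<lambda>x y. relNeg B (dSN x) (dN y),
    tens = \<lambda>x y. eP (tens B (gP x) (gP y)),
    osl = \<lambda>x y. eP (osl B (gP x) (gN y)),
    omin = \<lambda>x y. eP (omin B (gN x) (gP y)),
    opl = \<lambda>x y. eN (opl B (gN x) (gN y)),
    bsl = \<lambda>x y. eN (bsl B (gP x) (gN y)),
    sla = \<lambda>x y. eN (sla B (gN x) (gP y)),
    tensl = \<lambda>x y. eSN (tensl B (gN x) (gP y)),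
    osll = \<lambda>x y. eSN (osll B (gN x) (gN y)),
    ominl = \<lambda>x y. eSN (ominl B (gP x) (gP y)),
    opll = \<lambda>x y. eSP (opll B (gP x) (gN y)),
    bsll = \<lambda>x y. eSP (bsll B (gN x) (gN y)),
    slal = \<lambda>x y. eSP (slal B (gP x) (gP y)),
    tensr = \<lambda>x y. eSN (tensr B (gP x) (gN y)),
    oslr = \<lambda>x y. eSN (oslr B (gP x) (gP y)),
    ominr = \<lambda>x y. eSN (ominr B (gN x) (gN y)),
    oplr = \<lambda>x y. eSP (oplr B (gN x) (gP y)),
    bslr = \<lambda>x y. eSP (bslr B (gP x) (gP y)),
    slar = \<lambda>x y. eSP (slar B (gN x) (gN y))\<rparr>"

section \<open>Decoding as an embedding of algebras\<close>

lemma inv_mem: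
  "z \<in> range (int_pos_st B v w) \<Longrightarrow> eP z \<in> KP \<and> dP (eP z) = z"
  "z' \<in> range (int_spos_st B v w) \<Longrightarrow> eSP z' \<in> KSP \<and> dSP (eSP z') = z'"
  "y \<in> range (int_neg_st B v w) \<Longrightarrow> eN y \<in> KN \<and> dN (eN y) = y"
  "y' \<in> range (int_sneg_st B v w) \<Longrightarrow> eSN y' \<in> KSN \<and> dSN (eSN y') = y'"
  using bijP bijSP bijN bijSN
  by (auto simp: bij_betw_def intro!: inv_into_into f_inv_into_f)

lemma dec_range:
  "x \<in> KP \<Longrightarrow> dP x \<in> range (int_pos_st B v w)"
  "x' \<in> KSP \<Longrightarrow> dSP x' \<in> range (int_spos_st B v w)"
  "y \<in> KN \<Longrightarrow> dN y \<in> range (int_neg_st B v w)"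
  "y' \<in> KSN \<Longrightarrow> dSN y' \<in> range (int_sneg_st B v w)"
  using bijP bijSP bijN bijSN by (auto simp: bij_betw_def)

lemma range_gpos: "range (int_gpos_st B v w) = range (int_pos_st B v w) <+> range (int_spos_st B v w)"
proof (intro equalityI subsetI)
  fix x assume "x \<in> range (int_gpos_st B v w)"
  then obtain X where "x = int_gpos_st B v w X" by blast
  then show "x \<in> range (int_pos_st B v w) <+> range (int_spos_st B v w)" by (cases X) auto
qed (auto elim!: PlusE simp flip: int_gpos_st.simps)

lemma range_gneg: "range (int_gneg_st B v w) = range (int_neg_st B v w) <+> range (int_sneg_st B v w)"
proof (intro equalityI subsetI)
  fix x assume "x \<in> range (int_gneg_st B v w)"
  then obtain X where "x = int_gneg_st B v w X" by blast
  then show "x \<in> range (int_neg_st B v w) <+> range (int_sneg_st B v w)" by (cases X) auto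
qed (auto elim!: PlusE simp flip: int_gneg_st.simps)

lemma gdec_range:
  "x \<in> gcarP relab \<Longrightarrow> gP x \<in> range (int_gpos_st B v w)"
  "y \<in> gcarN relab \<Longrightarrow> gN y \<in> range (int_gneg_st B v w)"
  using dec_range by (auto simp: range_gpos range_gneg gcarP_def gcarN_def relab_def)

text \<open>Every operation, including the variants and double arrows, interprets a structural
  connective; reading the evaluation equations backwards exhibits the required structure.\<close>

lemma range_closed:
  "p0 \<in> range (int_pos_st B v w) \<Longrightarrow> up B p0 \<in> range (int_sneg_st B v w)"
  "p1 \<in> range (int_sneg_st B v w) \<Longrightarrow> ddown B p1 \<in> range (int_pos_st B v w)"
  "p2 \<in> range (int_spos_st B v w) \<Longrightarrow> uup B p2 \<in> range (int_neg_st B v w)"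
  "p3 \<in> range (int_neg_st B v w) \<Longrightarrow> down B p3 \<in> range (int_spos_st B v w)"
  "x0 \<in> range (int_gpos_st B v w) \<Longrightarrow> y0 \<in> range (int_gpos_st B v w) \<Longrightarrow>
    tens B x0 y0 \<in> range (int_pos_st B v w)"
  "x1 \<in> range (int_gpos_st B v w) \<Longrightarrow> y1 \<in> range (int_gneg_st B v w) \<Longrightarrow>
    osl B x1 y1 \<in> range (int_pos_st B v w)"
  "x2 \<in> range (int_gneg_st B v w) \<Longrightarrow> y2 \<in> range (int_gpos_st B v w) \<Longrightarrow>
    omin B x2 y2 \<in> range (int_pos_st B v w)"
  "x3 \<in> range (int_gneg_st B v w) \<Longrightarrow> y3 \<in> range (int_gneg_st B v w) \<Longrightarrow>
    opl B x3 y3 \<in> range (int_neg_st B v w)"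
  "x4 \<in> range (int_gpos_st B v w) \<Longrightarrow> y4 \<in> range (int_gneg_st B v w) \<Longrightarrow>
    bsl B x4 y4 \<in> range (int_neg_st B v w)"
  "x5 \<in> range (int_gneg_st B v w) \<Longrightarrow> y5 \<in> range (int_gpos_st B v w) \<Longrightarrow>
    sla B x5 y5 \<in> range (int_neg_st B v w)"
  "x6 \<in> range (int_gneg_st B v w) \<Longrightarrow> y6 \<in> range (int_gpos_st B v w) \<Longrightarrow>
    tensl B x6 y6 \<in> range (int_sneg_st B v w)"
  "x7 \<in> range (int_gneg_st B v w) \<Longrightarrow> y7 \<in> range (int_gneg_st B v w) \<Longrightarrow>
    osll B x7 y7 \<in> range (int_sneg_st B v w)"
  "x8 \<in> range (int_gpos_st B v w) \<Longrightarrow> y8 \<in> range (int_gpos_st B v w) \<Longrightarrow>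
    ominl B x8 y8 \<in> range (int_sneg_st B v w)"
  "x9 \<in> range (int_gpos_st B v w) \<Longrightarrow> y9 \<in> range (int_gneg_st B v w) \<Longrightarrow>
    opll B x9 y9 \<in> range (int_spos_st B v w)"
  "x10 \<in> range (int_gneg_st B v w) \<Longrightarrow> y10 \<in> range (int_gneg_st B v w) \<Longrightarrow>
    bsll B x10 y10 \<in> range (int_spos_st B v w)"
  "x11 \<in> range (int_gpos_st B v w) \<Longrightarrow> y11 \<in> range (int_gpos_st B v w) \<Longrightarrow>
    slal B x11 y11 \<in> range (int_spos_st B v w)"
  "x12 \<in> range (int_gpos_st B v w) \<Longrightarrow> y12 \<in> range (int_gneg_st B v w) \<Longrightarrow>
    tensr B x12 y12 \<in> range (int_sneg_st B v w)"
  "x13 \<in> range (int_gpos_st B v w) \<Longrightarrow> y13 \<in> range (int_gpos_st B v w) \<Longrightarrow>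
    oslr B x13 y13 \<in> range (int_sneg_st B v w)"
  "x14 \<in> range (int_gneg_st B v w) \<Longrightarrow> y14 \<in> range (int_gneg_st B v w) \<Longrightarrow>
    ominr B x14 y14 \<in> range (int_sneg_st B v w)"
  "x15 \<in> range (int_gneg_st B v w) \<Longrightarrow> y15 \<in> range (int_gpos_st B v w) \<Longrightarrow>
    oplr B x15 y15 \<in> range (int_spos_st B v w)"
  "x16 \<in> range (int_gpos_st B v w) \<Longrightarrow> y16 \<in> range (int_gpos_st B v w) \<Longrightarrow>
    bslr B x16 y16 \<in> range (int_spos_st B v w)"
  "x17 \<in> range (int_gneg_st B v w) \<Longrightarrow> y17 \<in> range (int_gneg_st B v w) \<Longrightarrow>
    slar B x17 y17 \<in> range (int_spos_st B v w)"
  by (auto simp flip: int_pos_st.simps int_neg_st.simps int_spos_st.simps int_sneg_st.simps)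

text \<open>By closure of the ranges every computed value has a name, which makes the decoding maps
  homomorphisms on the carriers.\<close>

lemma dec_relab:
  "p0 \<in> carP relab \<Longrightarrow> up relab p0 \<in> carSN relab \<and> dSN (up relab p0) = up B (dP p0)"
  "p1 \<in> carSN relab \<Longrightarrow> ddown relab p1 \<in> carP relab \<and> dP (ddown relab p1) = ddown B (dSN p1)"
  "p2 \<in> carSP relab \<Longrightarrow> uup relab p2 \<in> carN relab \<and> dN (uup relab p2) = uup B (dSP p2)"
  "p3 \<in> carN relab \<Longrightarrow> down relab p3 \<in> carSP relab \<and> dSP (down relab p3) = down B (dN p3)"
  "x0 \<in> gcarP relab \<Longrightarrow> y0 \<in> gcarP relab \<Longrightarrow>
    tens relab x0 y0 \<in> carP relab \<and> dP (tens relab x0 y0) = tens B (gP x0) (gP y0)"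
  "x1 \<in> gcarP relab \<Longrightarrow> y1 \<in> gcarN relab \<Longrightarrow>
    osl relab x1 y1 \<in> carP relab \<and> dP (osl relab x1 y1) = osl B (gP x1) (gN y1)"
  "x2 \<in> gcarN relab \<Longrightarrow> y2 \<in> gcarP relab \<Longrightarrow>
    omin relab x2 y2 \<in> carP relab \<and> dP (omin relab x2 y2) = omin B (gN x2) (gP y2)"
  "x3 \<in> gcarN relab \<Longrightarrow> y3 \<in> gcarN relab \<Longrightarrow>
    opl relab x3 y3 \<in> carN relab \<and> dN (opl relab x3 y3) = opl B (gN x3) (gN y3)"
  "x4 \<in> gcarP relab \<Longrightarrow> y4 \<in> gcarN relab \<Longrightarrow>
    bsl relab x4 y4 \<in> carN relab \<and> dN (bsl relab x4 y4) = bsl B (gP x4) (gN y4)"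
  "x5 \<in> gcarN relab \<Longrightarrow> y5 \<in> gcarP relab \<Longrightarrow>
    sla relab x5 y5 \<in> carN relab \<and> dN (sla relab x5 y5) = sla B (gN x5) (gP y5)"
  "x6 \<in> gcarN relab \<Longrightarrow> y6 \<in> gcarP relab \<Longrightarrow>
    tensl relab x6 y6 \<in> carSN relab \<and> dSN (tensl relab x6 y6) = tensl B (gN x6) (gP y6)"
  "x7 \<in> gcarN relab \<Longrightarrow> y7 \<in> gcarN relab \<Longrightarrow>
    osll relab x7 y7 \<in> carSN relab \<and> dSN (osll relab x7 y7) = osll B (gN x7) (gN y7)"
  "x8 \<in> gcarP relab \<Longrightarrow> y8 \<in> gcarP relab \<Longrightarrow>
    ominl relab x8 y8 \<in> carSN relab \<and> dSN (ominl relab x8 y8) = ominl B (gP x8) (gP y8)"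
  "x9 \<in> gcarP relab \<Longrightarrow> y9 \<in> gcarN relab \<Longrightarrow>
    opll relab x9 y9 \<in> carSP relab \<and> dSP (opll relab x9 y9) = opll B (gP x9) (gN y9)"
  "x10 \<in> gcarN relab \<Longrightarrow> y10 \<in> gcarN relab \<Longrightarrow>
    bsll relab x10 y10 \<in> carSP relab \<and> dSP (bsll relab x10 y10) = bsll B (gN x10) (gN y10)"
  "x11 \<in> gcarP relab \<Longrightarrow> y11 \<in> gcarP relab \<Longrightarrow>
    slal relab x11 y11 \<in> carSP relab \<and> dSP (slal relab x11 y11) = slal B (gP x11) (gP y11)"
  "x12 \<in> gcarP relab \<Longrightarrow> y12 \<in> gcarN relab \<Longrightarrow>
    tensr relab x12 y12 \<in> carSN relab \<and> dSN (tensr relab x12 y12) = tensr B (gP x12) (gN y12)"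
  "x13 \<in> gcarP relab \<Longrightarrow> y13 \<in> gcarP relab \<Longrightarrow>
    oslr relab x13 y13 \<in> carSN relab \<and> dSN (oslr relab x13 y13) = oslr B (gP x13) (gP y13)"
  "x14 \<in> gcarN relab \<Longrightarrow> y14 \<in> gcarN relab \<Longrightarrow>
    ominr relab x14 y14 \<in> carSN relab \<and> dSN (ominr relab x14 y14) = ominr B (gN x14) (gN y14)"
  "x15 \<in> gcarN relab \<Longrightarrow> y15 \<in> gcarP relab \<Longrightarrow>
    oplr relab x15 y15 \<in> carSP relab \<and> dSP (oplr relab x15 y15) = oplr B (gN x15) (gP y15)"
  "x16 \<in> gcarP relab \<Longrightarrow> y16 \<in> gcarP relab \<Longrightarrow>
    bslr relab x16 y16 \<in> carSP relab \<and> dSP (bslr relab x16 y16) = bslr B (gP x16) (gP y16)"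
  "x17 \<in> gcarN relab \<Longrightarrow> y17 \<in> gcarN relab \<Longrightarrow>
    slar relab x17 y17 \<in> carSP relab \<and> dSP (slar relab x17 y17) = slar B (gN x17) (gN y17)"
  using dec_range gdec_range by (simp_all add: relab_def inv_mem range_closed)

lemma le_pos_relab: "le_pos relab x y \<longleftrightarrow> le_pos B (gP x) (gP y)"
  by (cases x; cases y) (simp_all add: relab_def)

lemma le_neg_relab: "le_neg relab x y \<longleftrightarrow> le_neg B (gN x) (gN y)"
  by (cases x; cases y) (simp_all add: relab_def)

lemma le_relab:
  "leP relab = (\<lambda>x y. leP B (dP x) (dP y))" "leSP relab = (\<lambda>x y. leSP B (dSP x) (dSP y))"
  "leN relab = (\<lambda>x y. leN B (dN x) (dN y))" "leSN relab = (\<lambda>x y. leSN B (dSN x) (dSN y))"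
  "relPos relab = (\<lambda>x y. relPos B (dP x) (dSP y))" "relNeut relab = (\<lambda>x y. relNeut B (dP x) (dN y))"
  "relNeg relab = (\<lambda>x y. relNeg B (dSN x) (dN y))"
  by (simp_all add: relab_def)

text \<open>Unlike the other two relations this one may apply \<open>up\<close> or
  \<open>uup\<close> to its left argument, and decoding commutes with these on the carriers.\<close>

lemma le_neut_relab: "x \<in> gcarP relab \<Longrightarrow> le_neut relab x y \<longleftrightarrow> le_neut B (gP x) (gN y)"
  by (cases x; cases y) (simp_all add: dec_relab le_relab)

lemma dec_car:
  "x \<in> carP relab \<Longrightarrow> dP x \<in> carP B" "x' \<in> carSP relab \<Longrightarrow> dSP x' \<in> carSP B"
  "y \<in> carN relab \<Longrightarrow> dN y \<in> carN B" "y' \<in> carSN relab \<Longrightarrow> dSN y' \<in> carSN B"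
  by (auto simp: relab_def int_st_in_carrier[OF alg v w] dest!: dec_range)

lemma gdec_car: "x \<in> gcarP relab \<Longrightarrow> gP x \<in> gcarP B" "y \<in> gcarN relab \<Longrightarrow> gN y \<in> gcarN B"
  by (auto simp: int_st_in_carrier[OF alg v w] dest!: gdec_range)

lemma inj_relab: "inj_on dP (carP relab)" "inj_on dSP (carSP relab)" "inj_on dN (carN relab)" "inj_on dSN (carSN relab)"
  using bijP bijSP bijN bijSN by (auto simp: relab_def bij_betw_def)

text \<open>The axioms are universal statements; as decoding reflects the relations and commutes
  with the operations, each pulls back from \<open>B\<close>.\<close>

theorem fp_lg_algebra_relab: "fp_lg_algebra relab"
proof -
  have posets: "poset_on (carP relab) (leP relab)" "poset_on (carSP relab) (leSP relab)"
    "poset_on (carN relab) (leN relab)" "poset_on (carSN relab) (leSN relab)"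
    unfolding le_relab by (rule poset_on_pullback[OF fp_poset(1)[OF alg]] poset_on_pullback[OF fp_poset(2)[OF alg]]
        poset_on_pullback[OF fp_poset(3)[OF alg]] poset_on_pullback[OF fp_poset(4)[OF alg]];
        auto simp: dec_car inj_relab)+
  have shifts: "adjunction (carP relab) (leP relab) (carSN relab) (leSN relab) (up relab) (ddown relab)"
    "adjunction (carSP relab) (leSP relab) (carN relab) (leN relab) (uup relab) (down relab)"
    using fp_adjunction[OF alg] by (auto simp: adjunction_def monotone_on_def le_relab dec_relab dec_car)
  have weakening: "weakening_relation (carP relab) (leP relab) (carSP relab) (leSP relab) (relPos relab)"
    "weakening_relation (carP relab) (leP relab) (carN relab) (leN relab) (relNeut relab)"
    "weakening_relation (carSN relab) (leSN relab) (carN relab) (leN relab) (relNeg relab)"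
    using fp_weakening[OF alg] dec_car unfolding weakening_relation_def le_relab by meson+
  have polar: "\<forall>a\<in>carP relab. \<forall>b\<in>carN relab.
      (relNeg relab (up relab a) b \<longleftrightarrow> relNeut relab a b) \<and> (relNeut relab a b \<longleftrightarrow> relPos relab a (down relab b))"
    using fp_polarity[OF alg] by (simp add: le_relab dec_relab dec_car)
  have operations: "operation (gcarP relab) (le_pos relab) (gcarP relab) (le_pos relab)
      (carP relab) (leP relab) (tens relab)"
    "operation (gcarP relab) (le_pos relab) (gcarN relab) (le_neg relab)\<inverse>\<inverse>
      (carP relab) (leP relab) (osl relab)"
    "operation (gcarN relab) (le_neg relab)\<inverse>\<inverse> (gcarP relab) (le_pos relab)
      (carP relab) (leP relab) (omin relab)"
    "operation (gcarN relab) (le_neg relab) (gcarN relab) (le_neg relab)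
      (carN relab) (leN relab) (opl relab)"
    "operation (gcarP relab) (le_pos relab)\<inverse>\<inverse> (gcarN relab) (le_neg relab)
      (carN relab) (leN relab) (bsl relab)"
    "operation (gcarN relab) (le_neg relab) (gcarP relab) (le_pos relab)\<inverse>\<inverse>
      (carN relab) (leN relab) (sla relab)"
    "operation (gcarN relab) (le_neg relab) (gcarP relab) (le_pos relab)
      (carSN relab) (leSN relab) (tensl relab)"
    "operation (gcarN relab) (le_neg relab) (gcarN relab) (le_neg relab)\<inverse>\<inverse>
      (carSN relab) (leSN relab) (osll relab)"
    "operation (gcarP relab) (le_pos relab)\<inverse>\<inverse> (gcarP relab) (le_pos relab)
      (carSN relab) (leSN relab) (ominl relab)"
    "operation (gcarP relab) (le_pos relab) (gcarN relab) (le_neg relab)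
      (carSP relab) (leSP relab) (opll relab)"
    "operation (gcarN relab) (le_neg relab)\<inverse>\<inverse> (gcarN relab) (le_neg relab)
      (carSP relab) (leSP relab) (bsll relab)"
    "operation (gcarP relab) (le_pos relab) (gcarP relab) (le_pos relab)\<inverse>\<inverse>
      (carSP relab) (leSP relab) (slal relab)"
    "operation (gcarP relab) (le_pos relab) (gcarN relab) (le_neg relab)
      (carSN relab) (leSN relab) (tensr relab)"
    "operation (gcarP relab) (le_pos relab) (gcarP relab) (le_pos relab)\<inverse>\<inverse>
      (carSN relab) (leSN relab) (oslr relab)"
    "operation (gcarN relab) (le_neg relab)\<inverse>\<inverse> (gcarN relab) (le_neg relab)
      (carSN relab) (leSN relab) (ominr relab)"
    "operation (gcarN relab) (le_neg relab) (gcarP relab) (le_pos relab)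
      (carSP relab) (leSP relab) (oplr relab)"
    "operation (gcarP relab) (le_pos relab)\<inverse>\<inverse> (gcarP relab) (le_pos relab)
      (carSP relab) (leSP relab) (bslr relab)"
    "operation (gcarN relab) (le_neg relab) (gcarN relab) (le_neg relab)\<inverse>\<inverse>
      (carSP relab) (leSP relab) (slar relab)"
    by (rule operation_pullback[OF fp_operation(1)[OF alg], where g = gP and h = gP and k = dP]
        operation_pullback[OF fp_operation(2)[OF alg], where g = gP and h = gN and k = dP]
        operation_pullback[OF fp_operation(3)[OF alg], where g = gN and h = gP and k = dP]
        operation_pullback[OF fp_operation(4)[OF alg], where g = gN and h = gN and k = dN]
        operation_pullback[OF fp_operation(5)[OF alg], where g = gP and h = gN and k = dN]
        operation_pullback[OF fp_operation(6)[OF alg], where g = gN and h = gP and k = dN]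
        operation_pullback[OF fp_operation(7)[OF alg], where g = gN and h = gP and k = dSN]
        operation_pullback[OF fp_operation(8)[OF alg], where g = gN and h = gN and k = dSN]
        operation_pullback[OF fp_operation(9)[OF alg], where g = gP and h = gP and k = dSN]
        operation_pullback[OF fp_operation(10)[OF alg], where g = gP and h = gN and k = dSP]
        operation_pullback[OF fp_operation(11)[OF alg], where g = gN and h = gN and k = dSP]
        operation_pullback[OF fp_operation(12)[OF alg], where g = gP and h = gP and k = dSP]
        operation_pullback[OF fp_operation(13)[OF alg], where g = gP and h = gN and k = dSN]
        operation_pullback[OF fp_operation(14)[OF alg], where g = gP and h = gP and k = dSN]
        operation_pullback[OF fp_operation(15)[OF alg], where g = gN and h = gN and k = dSN]
        operation_pullback[OF fp_operation(16)[OF alg], where g = gN and h = gP and k = dSP]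
        operation_pullback[OF fp_operation(17)[OF alg], where g = gP and h = gP and k = dSP]
        operation_pullback[OF fp_operation(18)[OF alg], where g = gN and h = gN and k = dSP];
        simp add: gdec_car dec_relab le_relab le_pos_relab le_neg_relab)+
  show ?thesis
    unfolding fp_lg_algebra_def Let_def
    by (intro conjI posets shifts weakening polar operations ballI)
      (simp_all add: dec_relab gdec_car le_pos_relab le_neg_relab le_neut_relab fp_residuation[OF alg])
qed

section \<open>The copied valuation\<close>

abbreviation "vA \<equiv> \<lambda>i. eP (v i)"
abbreviation "wA \<equiv> \<lambda>i. eN (w i)"

lemma val_relab: "vA i \<in> carP relab \<and> dP (vA i) = v i" "wA i \<in> carN relab \<and> dN (wA i) = w i"
proof -
  \<comment> \<open>Atoms are structures too, so their values have names.\<close>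
  have "v i = int_pos_st B v w (FmP (PAtom i))" "w i = int_neg_st B v w (FmN (NAtom i))"
    by simp_all
  then show "vA i \<in> carP relab \<and> dP (vA i) = v i" "wA i \<in> carN relab \<and> dN (wA i) = w i"
    using inv_mem(1)[of "v i"] inv_mem(3)[of "w i"] by (auto simp: relab_def simp del: int_pos_st.simps int_neg_st.simps)
qed

lemmas int_fm_relab = int_fm_in_carrier[OF fp_lg_algebra_relab conjunct1[OF val_relab(1)] conjunct1[OF val_relab(2)]]
lemmas int_st_relab = int_st_in_carrier[OF fp_lg_algebra_relab conjunct1[OF val_relab(1)] conjunct1[OF val_relab(2)]]

lemma dec_int_fm:
  "dP (int_pos_fm relab vA wA P1) = int_pos_fm B v w P1"
  "dN (int_neg_fm relab vA wA P2) = int_neg_fm B v w P2"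
  "dSP (int_spos_fm relab vA wA P3) = int_spos_fm B v w P3"
  "dSN (int_sneg_fm relab vA wA P4) = int_sneg_fm B v w P4"
  "gP (int_gpos_fm relab vA wA P5) = int_gpos_fm B v w P5"
  "gN (int_gneg_fm relab vA wA P6) = int_gneg_fm B v w P6"
  by (induction P1 and P2 and P3 and P4 and P5 and P6)
    (simp_all add: val_relab dec_relab int_fm_relab)

lemma dec_int_st:
  "dP (int_pos_st relab vA wA X1) = int_pos_st B v w X1"
  "dN (int_neg_st relab vA wA X2) = int_neg_st B v w X2"
  "dSP (int_spos_st relab vA wA X3) = int_spos_st B v w X3"
  "dSN (int_sneg_st relab vA wA X4) = int_sneg_st B v w X4"
  "gP (int_gpos_st relab vA wA X5) = int_gpos_st B v w X5"
  "gN (int_gneg_st relab vA wA X6) = int_gneg_st B v w X6"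
  by (induction X1 and X2 and X3 and X4 and X5 and X6)
    (simp_all add: dec_int_fm dec_relab int_st_relab)

lemma holds_relab: "holds relab vA wA S \<longleftrightarrow> holds B v w S"
  by (cases S) (simp_all add: le_pos_relab le_neg_relab le_neut_relab int_st_relab dec_int_st)

end

section \<open>Transfer of validity and completeness\<close>

lemma ex_bij_betw_countable:
  assumes "countable R" and "infinite (UNIV :: 'a set)"
  obtains d and K :: "'a set" where "bij_betw d K R"
proof -
  obtain f :: "nat \<Rightarrow> 'a" where "inj f"
    using infinite_countable_subset[OF assms(2)] by blast
  \<comment> \<open>\<open>K\<close> is the image of \<open>R\<close> under this injection and
    \<open>d\<close> its inverse.\<close>
  then have "inj_on (f \<circ> to_nat_on R) R"
    using assms(1) by (intro comp_inj_on) (auto intro: inj_on_subset)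
  then show thesis
    using that bij_betw_inv_into[OF inj_on_imp_bij_betw] by blast
qed

text \<open>A downward Loewenheim-Skolem argument: the values of structures decide \<open>S\<close>,
  they are countably many, and their copy in the infinite target types is an algebra covered by the
  hypothesis.\<close>

theorem holds_if_valid:
  fixes B :: "('a, 'b, 'c, 'd) lg_structure"
  assumes "infinite (UNIV :: 'p set)" and "infinite (UNIV :: 'sp set)"
    and "infinite (UNIV :: 'n set)" and "infinite (UNIV :: 'sn set)"
    and "\<And>A :: ('p, 'sp, 'n, 'sn) lg_structure. fp_lg_algebra A \<Longrightarrow> valid_in A S"
    and "fp_lg_algebra B" and "\<And>i. v i \<in> carP B" and "\<And>i. w i \<in> carN B"
  shows "holds B v w S"
proof -
  obtain dP and KP :: "'p set" where "bij_betw dP KP (range (int_pos_st B v w))"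
    using ex_bij_betw_countable[OF _ assms(1)] by (metis countable_image countableI_type)
  moreover obtain dSP and KSP :: "'sp set" where "bij_betw dSP KSP (range (int_spos_st B v w))"
    using ex_bij_betw_countable[OF _ assms(2)] by (metis countable_image countableI_type)
  moreover obtain dN and KN :: "'n set" where "bij_betw dN KN (range (int_neg_st B v w))"
    using ex_bij_betw_countable[OF _ assms(3)] by (metis countable_image countableI_type)
  moreover obtain dSN and KSN :: "'sn set" where "bij_betw dSN KSN (range (int_sneg_st B v w))"
    using ex_bij_betw_countable[OF _ assms(4)] by (metis countable_image countableI_type)
  ultimately interpret relabelling B v w KP KSP KN KSN dP dSP dN dSN
    using assms(6-8) by unfold_locales
  show ?thesis
    using assms(5)[OF fp_lg_algebra_relab] val_relab by (simp add: valid_in_def flip: holds_relab)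
qed

theorem theorem29:
  fixes S T :: sequent
  assumes "infinite (UNIV :: 'p set)" and "infinite (UNIV :: 'sp set)"
    and "infinite (UNIV :: 'n set)" and "infinite (UNIV :: 'sn set)"
    and "standard_sequent S = Some T"
    and "\<And>A :: ('p, 'sp, 'n, 'sn) lg_structure. fp_lg_algebra A \<Longrightarrow> valid_in A S"
  shows "derivable T"
proof -
  \<comment> \<open>The canonical elements are sets of structures, so validity over the given types
    reaches them through the countable copy.\<close>
  have holds: "holds canonical canP canN S"
    using holds_if_valid[OF assms(1-4,6) canonical_fp_lg_algebra canP_carP canN_carN] .
  show ?thesis
  proof (cases S)
    case (PosSeq X Y)
    \<comment> \<open>The standardised left side lies in the value of \<open>X\<close>, hence in
      that of \<open>Y\<close>, whose members all derive the standardised right side.\<close>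
    then show ?thesis
      using assms(5) holds truth_st(5)[of X] truth_st(5)[of Y] le_pos_low by fastforce
  next
    case (NegSeq G D)
    \<comment> \<open>Here inclusion runs backwards: the standardised \<open>D\<close> lies in the
      value of \<open>G\<close>, whose members are all derivable from the standardised
      \<open>G\<close>.\<close>
    then show ?thesis
      using assms(5) holds truth_st(6)[of G] truth_st(6)[of D] le_neg_upp by fastforce
  next
    case (NeutSeq X D)
    \<comment> \<open>The neutral relation directly relates the two standardised sides, as members
      of their values.\<close>
    then show ?thesis
      using assms(5) holds truth_st(5)[of X] truth_st(6)[of D] le_neut_derivable by fastforce
  qed
qed

end
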